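(* Let $a<t<b$, $T=b-a$, let $m\geq 1$ be an integer, let $g\in C^\infty[a,b]$, and let $f$ be a $T$-periodic function, $f\in C^\infty(\mathbb{R}_t)$ with $\mathbb{R}_t=\mathbb{R}\setminus\{t+kT: k\in\mathbb{Z}\}$, such that $f(x)=g(x)/(x-t)^m$ for $x\in[a,b]\setminus\{t\}$. Let $I[f]$ denote the Hadamard finite part of $\int_a^b f(x)\,dx$, and let $\widehat{T}^{(s)}_{m,n}[f]$, $s=0,1,2,\ldots$, be the numerical quadrature formulas defined in the context. Then, for every $s$, $\lim_{n\to\infty}\widehat{T}^{(s)}_{m,n}[f]=I[f]$, and $$\widehat{T}^{(s)}_{m,n}[f]-I[f]=o(n^{-\mu})\quad\text{as } n\to\infty,\quad\forall\,\mu>0.$$ That is, the errors in the $\widehat{T}^{(s)}_{m,n}[f]$ tend to zero as $n\to\infty$ faster than every negative power of $n$.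
   Context: Hadamard finite part (HFP): $I[f]$ is the finite part of the divergent integral $\int_a^b f(x)\,dx$, i.e. the constant term remaining when $\int_a^{t-\epsilon}f(x)\,dx+\int_{t+\epsilon}^b f(x)\,dx$ is expanded as $\epsilon\to0+$ and the terms that diverge are discarded. Explicitly, for $f(x)=g(x)/(x-t)^m$, $$I[f]=\lim_{\epsilon\to0+}\Bigg[\int_a^{t-\epsilon}f(x)\,dx+\int_{t+\epsilon}^b f(x)\,dx-\sum_{i=0}^{m-2}\big[1+(-1)^{i-m}\big]\frac{g^{(i)}(t)}{i!}\,\frac{\epsilon^{\,i-m+1}}{m-1-i}\Bigg]$$ (the sum being empty when $m=1$, in which case $I[f]$ is the Cauchy principal value). Quadrature formulas: let $\zeta$ be the Riemann zeta function (so $\zeta(0)=-\tfrac12$), $n\ge1$ an integer, $h=T/n$, and $\widetilde{T}_{m,n}[f]=h\sum_{j=1}^{n-1}f(t+jh)$. Define $$\widehat{T}^{(0)}_{m,n}[f]=\widetilde{T}_{m,n}[f]-2\sum_{i=0}^{r}\frac{g^{(2i)}(t)}{(2i)!}\,\zeta(2r-2i)\,h^{-2r+2i+1}\quad\text{if } m=2r,\ r=1,2,\ldots,$$ $$\widehat{T}^{(0)}_{m,n}[f]=\widetilde{T}_{m,n}[f]-2\sum_{i=0}^{r}\frac{g^{(2i+1)}(t)}{(2i+1)!}\,\zeta(2r-2i)\,h^{-2r+2i+1}\quad\text{if } m=2r+1,\ r=0,1,\ldots.$$ For $s\ge1$, $\widehat{T}^{(s)}_{m,n}[f]$ is obtained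 by $s$ steps of a Richardson-like extrapolation applied to $\widehat{T}^{(0)}_{m,n}[f],\widehat{T}^{(0)}_{m,2n}[f],\ldots,\widehat{T}^{(0)}_{m,2^sn}[f]$, eliminating successively the powers $h^1,h^{-1},h^{-3},\ldots,h^{-2s+3}$; that is, with $p_s=3-2s$, $$\widehat{T}^{(s)}_{m,n}[f]=\frac{\widehat{T}^{(s-1)}_{m,2n}[f]-2^{-p_s}\,\widehat{T}^{(s-1)}_{m,n}[f]}{1-2^{-p_s}},\qquad s=1,2,\ldots.$$ Thus $\widehat{T}^{(1)}_{m,n}=2\widehat{T}^{(0)}_{m,2n}-\widehat{T}^{(0)}_{m,n}$, $\widehat{T}^{(2)}_{m,n}=2\widehat{T}^{(1)}_{m,n}-\widehat{T}^{(1)}_{m,2n}$, $\widehat{T}^{(3)}_{m,n}=\frac87\widehat{T}^{(2)}_{m,n}-\frac17\widehat{T}^{(2)}_{m,2n}$, and in general $\widehat{T}^{(s)}_{m,n}[f]=\sum_{k=0}^s\alpha^{(s)}_{m,k}\widehat{T}^{(0)}_{m,2^kn}[f]$ with $\sum_{k=0}^s\alpha^{(s)}_{m,k}=1$ and $\alpha^{(s)}_{m,k}$ independent of $n$. For example, for $m=3$ and $h=T/n$ these are $$\widehat{T}^{(0)}_{3,n}[f]=h\sum_{j=1}^{n-1}f(t+jh)-\frac{\pi^2}{3}g'(t)h^{-1}+\frac16 g'''(t)h,$$ $$\widehat{T}^{(1)}_{3,n}[f]=h\sum_{j=1}^{n}f(t+jh-h/2)-\pi^2g'(t)h^{-1},$$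 $$\widehat{T}^{(2)}_{3,n}[f]=2h\sum_{j=1}^{n}f(t+jh-h/2)-\frac h2\sum_{j=1}^{2n}f(t+jh/2-h/4).$$ *)

theory Defs
  imports "HOL-Complex_Analysis.Complex_Analysis" "HOL-Library.Landau_Symbols"
begin

text \<open>
  \<open>f\<close> is \<open>C\<^sup>\<infinity>\<close> on \<open>S\<close>: \<open>F k\<close> is the \<open>k\<close>-th derivative of \<open>f\<close> relative to \<open>S\<close>, which is one-sided
  at the end points if \<open>S\<close> is a compact interval and is the usual one if \<open>S\<close> is open.
\<close>
definition smooth_on :: "real set \<Rightarrow> (real \<Rightarrow> real) \<Rightarrow> bool" where
  "smooth_on S f \<longleftrightarrow>
     (\<exists>F :: nat \<Rightarrow> real \<Rightarrow> real. F 0 = f \<and>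
        (\<forall>k. \<forall>x\<in>S. (F k has_real_derivative F (Suc k) x) (at x within S)))"

text \<open>
  The Riemann zeta function: the analytic continuation of \<open>\<Sum>k\<ge>1. k\<^bsup>-s\<^esup>\<close> from \<open>Re s > 1\<close> to the
  plane without \<open>1\<close>. It is unique there by the identity theorem; its value at \<open>1\<close> is arbitrary.
\<close>
definition riemann_zeta :: "complex \<Rightarrow> complex" where
  "riemann_zeta = (SOME Z. Z holomorphic_on (- {1}) \<and>
     (\<forall>s. Re s > 1 \<longrightarrow> (\<lambda>k. of_nat (Suc k) powr (- s)) sums Z s))"

text \<open>
  Hadamard finite part of \<open>\<integral>\<^sub>a\<^sup>b f\<close> for \<open>f x = g x / (x - t) ^ m\<close> with \<open>m \<ge> 1\<close>. The index set \<open>{..<m - 1}\<close>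
  is \<open>0, \<dots>, m - 2\<close>, empty for \<open>m = 1\<close>. As \<open>t\<close> is an interior point of \<open>[a, b]\<close>, iterating
  \<^const>\<open>deriv\<close> at \<open>t\<close> gives the derivatives of \<open>g\<close> on \<open>[a, b]\<close>, whatever \<open>g\<close> is outside.
\<close>
definition hadamard_finite_part ::
  "real \<Rightarrow> real \<Rightarrow> real \<Rightarrow> nat \<Rightarrow> (real \<Rightarrow> real) \<Rightarrow> (real \<Rightarrow> real) \<Rightarrow> real" where
  "hadamard_finite_part a b t m g f =
     Lim (at_right 0) (\<lambda>\<epsilon>.
       integral {a..t - \<epsilon>} f + integral {t + \<epsilon>..b} f
       - (\<Sum>i<m - 1. (1 + (-1) powi (int i - int m)) * ((deriv ^^ i) g t / fact i)
            * (\<epsilon> powi (int i - int m + 1) / (real m - 1 - real i))))"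

definition punctured_trapezoid :: "real \<Rightarrow> real \<Rightarrow> (real \<Rightarrow> real) \<Rightarrow> nat \<Rightarrow> real" where
  "punctured_trapezoid T t f n = (let h = T / real n in h * (\<Sum>j=1..<n. f (t + real j * h)))"

text \<open>
  In both cases \<open>r = m div 2\<close>. The arguments \<open>2r - 2i\<close> of \<open>\<zeta>\<close> are even and nonnegative, and \<open>\<zeta>\<close> is
  real at these points, so that \<^const>\<open>Re\<close> only changes the type.
\<close>
definition quadrature0 ::
  "real \<Rightarrow> real \<Rightarrow> nat \<Rightarrow> (real \<Rightarrow> real) \<Rightarrow> (real \<Rightarrow> real) \<Rightarrow> nat \<Rightarrow> real" where
  "quadrature0 T t m g f n =
     (let h = T / real n; r = m div 2 in
      if even m then
        punctured_trapezoid T t f n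
        - 2 * (\<Sum>i\<le>r. (deriv ^^ (2 * i)) g t / fact (2 * i)
                 * Re (riemann_zeta (of_nat (2 * r - 2 * i))) * h powi (- 2 * int r + 2 * int i + 1))
      else
        punctured_trapezoid T t f n
        - 2 * (\<Sum>i\<le>r. (deriv ^^ (2 * i + 1)) g t / fact (2 * i + 1)
                 * Re (riemann_zeta (of_nat (2 * r - 2 * i))) * h powi (- 2 * int r + 2 * int i + 1)))"

definition richardson_exponent :: "nat \<Rightarrow> int" where
  "richardson_exponent s = 3 - 2 * int s"

primrec quadrature ::
  "nat \<Rightarrow> real \<Rightarrow> real \<Rightarrow> nat \<Rightarrow> (real \<Rightarrow> real) \<Rightarrow> (real \<Rightarrow> real) \<Rightarrow> nat \<Rightarrow> real" where
  "quadrature 0 T t m g f n = quadrature0 T t m g f n"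
| "quadrature (Suc s) T t m g f n =
     (let q = 2 powi (- richardson_exponent (Suc s)) in
      (quadrature s T t m g f (2 * n) - q * quadrature s T t m g f n) / (1 - q))"

end

theory Submission
  imports Defs
begin

text \<open>
  Put \<open>h = T / n\<close>. The proof compares \<open>f\<close> with the \<open>T\<close>-periodic functions
  \<open>K\<^sub>k x = \<Sum>l\<in>\<int>. (x - t + l T)\<^bsup>-(k+1)\<^esup>\<close> (for \<open>k = 0\<close>, \<open>\<pi> / T\<close> times the cotangent of
  \<open>\<pi> (x - t) / T\<close>), each of which has a single pole per period. If \<open>c\<^sub>k\<close> is the coefficient of
  \<open>(x - t)\<^bsup>-(k+1)\<^esup>\<close> in the expansion of \<open>f\<close> at \<open>t\<close>, then \<open>f = \<Sum>k<m. c\<^sub>k K\<^sub>k + R\<close> with \<open>R\<close> smooth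
  and periodic on the whole line (\<open>smooth_periodic_remainder\<close>), and the two parts can be treated
  separately.

  For \<open>K\<^sub>k\<close> there is no error at all. Its finite part is \<open>0\<close>: for \<open>k > 0\<close> there is the periodic
  antiderivative \<open>- K\<^sub>k\<^sub>-\<^sub>1 / k\<close>, whose singular part gives exactly the terms that the finite part
  discards, and for \<open>k = 0\<close> the principal value vanishes by symmetry
  (\<open>tendsto_integral_scaled_kernel\<close>). Its sum over the nodes \<open>t + j h\<close>, \<open>0 < j < n\<close>, collects
  every integer that is not a multiple of \<open>n\<close>, hence equals \<open>2 \<zeta>(k+1) (h\<^bsup>-(k+1)\<^esup> - T\<^bsup>-(k+1)\<^esup>)\<close> for
  odd \<open>k\<close> and \<open>0\<close> for even \<open>k\<close> (\<open>sum_pole_kernel_odd\<close>, \<open>sum_pole_kernel_even\<close>). The first part of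
  this is what the zeta values at positive arguments in the quadrature formula remove. The second
  part is minus the value at \<open>t\<close> of the regular part of \<open>K\<^sub>k\<close>; together with the last correction,
  in which \<open>\<zeta>(0) = - 1 / 2\<close> turns into \<open>+ h g\<^sup>(\<^sup>m\<^sup>)(t) / m!\<close>, it supplies precisely the missing
  node value \<open>h R(t)\<close>.

  Consequently the finite part of \<open>f\<close> is the ordinary integral of \<open>R\<close>
  (\<open>hadamard_finite_part_eq_integral\<close>), the formula without extrapolation is the ordinary
  trapezoidal sum of \<open>R\<close> (\<open>quadrature0_eq_trapezoid\<close>), and its error is below every power of \<open>h\<close>
  by \<open>periodic_trapezoid\<close>. Each Richardson step combines two such values with fixed weights of sum
  one.

  The zeta function enters through its values at \<open>0\<close> and at even positive integers. As it is given
  by analytic continuation, the existence of the continuation has to be established first;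
  \<open>zeta_halfplane_extension\<close> does this by moving the boundary to the left one unit at a time.
\<close>

section \<open>Analytic continuation of the zeta function\<close>

text \<open>
  A bound of the size of \<open>(n + 1)\<^bsup>-s-\<kappa>\<^esup>\<close>, locally uniform in \<open>s\<close>, gives normal convergence on the
  half-plane \<open>Re (s + \<kappa>) > 1\<close>. With \<open>\<kappa> = 0\<close> this covers the zeta series itself, with \<open>\<kappa> = K\<close> the
  series of Taylor remainders that carries out the continuation.
\<close>
lemma dirichlet_type_series:
  fixes u :: "nat \<Rightarrow> complex \<Rightarrow> complex" and C :: "complex \<Rightarrow> real"
  assumes hol: "\<And>n. u n holomorphic_on {s. Re s > 1 - \<kappa>}"
    and cont: "continuous_on UNIV C"
    and bound: "\<And>n s. Re s > 1 - \<kappa> \<Longrightarrow> norm (u n s) \<le> C s * real (Suc n) powr (- Re s - \<kappa>)"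
  shows "Re s > 1 - \<kappa> \<Longrightarrow> summable (\<lambda>n. u n s)"
    and "(\<lambda>s. \<Sum>n. u n s) holomorphic_on {s. Re s > 1 - \<kappa>}"
proof -
  have summ: "summable (\<lambda>n. B * real (Suc n) powr (- \<sigma> - \<kappa>))" if "\<sigma> > 1 - \<kappa>" for B \<sigma>
  proof -
    have "summable (\<lambda>n. real n powr (- \<sigma> - \<kappa>))"
      using that by (simp add: summable_real_powr_iff)
    then have "summable (\<lambda>n. real (Suc n) powr (- \<sigma> - \<kappa>))"
      by (subst summable_Suc_iff)
    then show ?thesis by (rule summable_mult)
  qed
  show "summable (\<lambda>n. u n s)" if "Re s > 1 - \<kappa>" for s
    using bound[OF that] by (intro summable_comparison_test'[OF summ[OF that, of "C s"]]) auto
  show "(\<lambda>s. \<Sum>n. u n s) holomorphic_on {s. Re s > 1 - \<kappa>}"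
  proof (rule holomorphic_uniform_sequence)
    show "open {s. Re s > 1 - \<kappa>}" by (rule open_halfspace_Re_gt)
    show "(\<lambda>s. \<Sum>n<N. u n s) holomorphic_on {s. Re s > 1 - \<kappa>}" for N
      by (intro holomorphic_intros hol)
    fix x assume "x \<in> {s. Re s > 1 - \<kappa>}"
    then have x: "Re x > 1 - \<kappa>" by simp
    define d where "d = (Re x - (1 - \<kappa>)) / 2"
    define \<sigma> where "\<sigma> = Re x - d"
    have d: "d > 0" and \<sigma>: "\<sigma> > 1 - \<kappa>" using x by (auto simp: d_def \<sigma>_def field_simps)
    have re: "Re s \<ge> \<sigma>" if "s \<in> cball x d" for s
      using that abs_Re_le_cmod[of "x - s"] by (auto simp: \<sigma>_def dist_norm)
    have "bounded (C ` cball x d)"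
      by (intro compact_imp_bounded compact_continuous_image continuous_on_subset[OF cont]) auto
    then obtain B where B: "\<And>s. s \<in> cball x d \<Longrightarrow> \<bar>C s\<bar> \<le> B"
      unfolding bounded_iff by force
    have "uniform_limit (cball x d) (\<lambda>N s. \<Sum>n<N. u n s) (\<lambda>s. \<Sum>n. u n s) sequentially"
    proof (rule Weierstrass_m_test[OF _ summ[OF \<sigma>, of B]])
      fix n s assume s: "s \<in> cball x d"
      have "norm (u n s) \<le> C s * real (Suc n) powr (- Re s - \<kappa>)"
        using re[OF s] \<sigma> by (intro bound) auto
      also have "\<dots> \<le> B * real (Suc n) powr (- \<sigma> - \<kappa>)"
        using B[OF s] re[OF s] by (intro mult_mono powr_mono) auto
      finally show "norm (u n s) \<le> B * real (Suc n) powr (- \<sigma> - \<kappa>)" .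
    qed
    moreover have "cball x d \<subseteq> {s. Re s > 1 - \<kappa>}"
      using re \<sigma> by force
    ultimately show "\<exists>d>0. cball x d \<subseteq> {s. Re s > 1 - \<kappa>} \<and>
        uniform_limit (cball x d) (\<lambda>N s. \<Sum>n<N. u n s) (\<lambda>s. \<Sum>n. u n s) sequentially"
      using d by blast
  qed
qed

definition zeta_series :: "complex \<Rightarrow> complex" where
  "zeta_series s = (\<Sum>n. of_nat (Suc n) powr (- s))"

text \<open>
  The remainder at order \<open>K\<close> of the Taylor expansion of \<open>x\<^bsup>1-s\<^esup>\<close> from \<open>x = n + 1\<close> to \<open>x = n + 2\<close>,
  so that all bases are positive.
\<close>
definition binomial_remainder :: "nat \<Rightarrow> nat \<Rightarrow> complex \<Rightarrow> complex" where
  "binomial_remainder K n s = of_nat (Suc (Suc n)) powr (1 - s)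
     - (\<Sum>i\<le>K. ((1 - s) gchoose i) * of_nat (Suc n) powr (1 - s - of_nat i))"

lemma zeta_series:
  shows zeta_series_sums: "Re s > 1 \<Longrightarrow> (\<lambda>n. of_nat (Suc n) powr (- s)) sums zeta_series s"
    and holomorphic_zeta_series: "zeta_series holomorphic_on {s. Re s > 1}"
proof -
  have hol: "(\<lambda>s. of_nat (Suc n) powr (- s)) holomorphic_on {s. Re s > 1 - 0}" for n
    by (intro holomorphic_intros)
  have bd: "norm (of_nat (Suc n) powr (- s) :: complex) \<le> 1 * real (Suc n) powr (- Re s - 0)"
    for n and s :: complex
    using norm_powr_real_powr[of "of_nat (Suc n)" "- s"] by simp
  note * = dirichlet_type_series[OF hol continuous_on_const bd]
  show "(\<lambda>n. of_nat (Suc n) powr (- s)) sums zeta_series s" if "Re s > 1"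
    unfolding zeta_series_def using *(1)[of s] that by (intro summable_sums) auto
  show "zeta_series holomorphic_on {s. Re s > 1}"
    unfolding zeta_series_def[abs_def] using *(2) by simp
qed

text \<open>
  Taylor's theorem on the segment from \<open>n + 1\<close> to \<open>n + 2\<close>. There the derivative of order \<open>K + 1\<close>
  of \<open>x\<^bsup>1-s\<^esup>\<close> has a modulus proportional to \<open>x\<^bsup>-Re s - K\<^esup>\<close>, which is largest at the left end.
\<close>
lemma norm_binomial_remainder_le:
  assumes "Re s > 1 - real K"
  shows "norm (binomial_remainder K n s)
    \<le> norm (\<Prod>j<Suc K. 1 - s - of_nat j) * real (Suc n) powr (- Re s - real K)"
proof -
  define f where "f = (\<lambda>i z. (\<Prod>j<i. 1 - s - of_nat j) * z powr (1 - s - of_nat i))"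
  \<comment> \<open>A real segment: there \<open>powr\<close> has no branch cut and its modulus depends on the real part of the exponent only.\<close>
  define S where "S = complex_of_real ` {real (Suc n)..real (Suc (Suc n))}"
  define B where "B = norm (\<Prod>j<Suc K. 1 - s - of_nat j) * real (Suc n) powr (- Re s - real K)"
  have w: "complex_of_real (real (Suc n)) \<in> S" and z: "complex_of_real (real (Suc (Suc n))) \<in> S"
    unfolding S_def by (intro imageI; simp)+
  have "norm (f 0 (of_real (real (Suc (Suc n)))) - (\<Sum>i\<le>K. f i (of_real (real (Suc n)))
            * (of_real (real (Suc (Suc n))) - of_real (real (Suc n))) ^ i / fact i))
          \<le> B * norm (complex_of_real (real (Suc (Suc n))) - of_real (real (Suc n))) ^ Suc K / fact K"
  proof (rule field_Taylor[OF _ _ _ w z])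
    show "convex S"
      unfolding S_def by (intro convex_linear_image) (auto simp: bounded_linear.linear bounded_linear_of_real)
    fix i x assume x: "x \<in> S"
    then have "x \<notin> \<real>\<^sub>\<le>\<^sub>0" by (auto simp: S_def)
    then show "(f i has_field_derivative f (Suc i) x) (at x within S)"
      unfolding f_def
      by (auto intro!: derivative_eq_intros simp: algebra_simps intro: has_field_derivative_at_within)
  next
    fix x assume "x \<in> S"
    then obtain y where y: "x = of_real y" "y \<ge> real (Suc n)" by (auto simp: S_def)
    have "norm (x powr (1 - s - of_nat (Suc K))) = y powr (- Re s - real K)"
      using norm_powr_real_powr[of x "1 - s - of_nat (Suc K)"] y by (simp add: algebra_simps)
    also have "\<dots> \<le> real (Suc n) powr (- Re s - real K)"
      using y assms by (intro powr_mono2') auto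
    finally show "norm (f (Suc K) x) \<le> B"
      unfolding f_def B_def norm_mult by (intro mult_left_mono) auto
  qed
  also have "(\<Sum>i\<le>K. f i (of_real (real (Suc n)))
      * (of_real (real (Suc (Suc n))) - of_real (real (Suc n))) ^ i / fact i)
    = (\<Sum>i\<le>K. ((1 - s) gchoose i) * of_nat (Suc n) powr (1 - s - of_nat i))"
    by (intro sum.cong) (auto simp: f_def gbinomial_prod_rev atLeast0LessThan)
  also have "f 0 (of_real (real (Suc (Suc n)))) = of_nat (Suc (Suc n)) powr (1 - s)"
    by (simp add: f_def)
  also have "B * norm (complex_of_real (real (Suc (Suc n))) - of_real (real (Suc n))) ^ Suc K / fact K \<le> B"
  proof -
    have "B * 1 \<le> B * fact K" by (intro mult_left_mono fact_ge_1) (simp add: B_def)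
    moreover have "complex_of_real (real (Suc (Suc n))) - of_real (real (Suc n)) = 1" by simp
    ultimately show ?thesis by (simp add: divide_le_eq del: of_nat_Suc)
  qed
  finally show ?thesis by (simp add: binomial_remainder_def B_def)
qed

lemma holomorphic_binomial_remainder_series:
  "(\<lambda>s. \<Sum>n. binomial_remainder K n s) holomorphic_on {s. Re s > 1 - real K}"
proof -
  have "binomial_remainder K n holomorphic_on {s. Re s > 1 - real K}" for n
    unfolding binomial_remainder_def[abs_def] gbinomial_prod_rev
    by (intro holomorphic_intros) auto
  moreover have "continuous_on UNIV (\<lambda>s. norm (\<Prod>j<Suc K. 1 - s - of_nat j :: complex))"
    by (intro continuous_intros)
  moreover note norm_binomial_remainder_le
  ultimately show ?thesis
    using dirichlet_type_series(2)[where \<kappa> = "real K" and u = "binomial_remainder K"] by blast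
qed

lemma gbinomial_Suc_mult:
  fixes a :: complex
  shows "(a gchoose Suc k) = (a gchoose k) * (a - of_nat k) / of_nat (Suc k)"
  by (simp add: gbinomial_prod_rev field_simps)

text \<open>
  Sum \<open>(n+2)\<^bsup>1-s\<^esup> - (n+1)\<^bsup>1-s\<^esup>\<close> over \<open>n\<close>. The sum telescopes to \<open>- 1\<close>, and expanding each term by
  Taylor's formula yields the values \<open>\<zeta>(s), \<zeta>(s + 1), \<dots>, \<zeta>(s + K - 1)\<close> and the remainders. Written
  for \<open>(s - 1) \<zeta>(s)\<close>, all poles cancel against the binomial coefficients, since
  \<open>((1 - s) gchoose i) = - ((1 - s) gchoose (i - 1)) (s + i - 2) / i\<close>.
\<close>
lemma zeta_series_recursion:
  assumes s: "Re s > 1" and K: "K \<ge> 1"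
  shows "(s - 1) * zeta_series s = 1 + (\<Sum>n. binomial_remainder K n s)
    - (\<Sum>i=2..K. ((1 - s) gchoose (i - 1)) / of_nat i
         * ((s + of_nat i - 1 - 1) * zeta_series (s + of_nat i - 1)))"
proof -
  define P where "P = (\<lambda>n. of_nat (Suc n) powr (1 - s) :: complex)"
  have "P \<longlonglongrightarrow> 0"
  proof (rule tendsto_norm_zero_cancel)
    have "(\<lambda>n. real (Suc n) powr (1 - Re s)) \<longlonglongrightarrow> 0"
      using s by real_asymp
    moreover have "norm (P n) = real (Suc n) powr (1 - Re s)" for n
      using norm_powr_real_powr[of "of_nat (Suc n)" "1 - s"] by (simp add: P_def)
    ultimately show "(\<lambda>n. norm (P n)) \<longlonglongrightarrow> 0" by simp
  qed
  then have "(\<lambda>n. P (Suc n) - P n) sums (0 - P 0)"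
    by (rule telescope_sums)
  moreover have "(\<lambda>n. ((1 - s) gchoose i) * of_nat (Suc n) powr (1 - s - of_nat i))
      sums (((1 - s) gchoose i) * zeta_series (s + of_nat i - 1))" if "i \<in> {1..K}" for i
  proof -
    have "Re (s + of_nat i - 1) > 1" using s that by auto
    from sums_mult[OF zeta_series_sums[OF this], of "(1 - s) gchoose i"]
    show ?thesis by (simp add: algebra_simps)
  qed
  then have "(\<lambda>n. \<Sum>i=1..K. ((1 - s) gchoose i) * of_nat (Suc n) powr (1 - s - of_nat i))
      sums (\<Sum>i=1..K. ((1 - s) gchoose i) * zeta_series (s + of_nat i - 1))"
    by (rule sums_sum)
  ultimately have "(\<lambda>n. P (Suc n) - P n
        - (\<Sum>i=1..K. ((1 - s) gchoose i) * of_nat (Suc n) powr (1 - s - of_nat i)))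
      sums (0 - P 0 - (\<Sum>i=1..K. ((1 - s) gchoose i) * zeta_series (s + of_nat i - 1)))"
    by (rule sums_diff)
  also have "(\<lambda>n. P (Suc n) - P n
        - (\<Sum>i=1..K. ((1 - s) gchoose i) * of_nat (Suc n) powr (1 - s - of_nat i)))
      = (\<lambda>n. binomial_remainder K n s)"
  proof
    fix n
    have "{..K} = insert 0 {1..K}" by auto
    then show "P (Suc n) - P n
        - (\<Sum>i=1..K. ((1 - s) gchoose i) * of_nat (Suc n) powr (1 - s - of_nat i))
      = binomial_remainder K n s"
      by (simp add: binomial_remainder_def P_def)
  qed
  finally have "(\<Sum>n. binomial_remainder K n s)
      = - 1 - (\<Sum>i=1..K. ((1 - s) gchoose i) * zeta_series (s + of_nat i - 1))"
    by (simp add: sums_iff P_def)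
  also have "{1..K} = insert 1 {2..K}" using K by auto
  also have "(\<Sum>i\<in>insert 1 {2..K}. ((1 - s) gchoose i) * zeta_series (s + of_nat i - 1))
      = (1 - s) * zeta_series s
        + (\<Sum>i=2..K. ((1 - s) gchoose i) * zeta_series (s + of_nat i - 1))"
    by simp
  also have "(\<Sum>i=2..K. ((1 - s) gchoose i) * zeta_series (s + of_nat i - 1))
      = - (\<Sum>i=2..K. ((1 - s) gchoose (i - 1)) / of_nat i
         * ((s + of_nat i - 1 - 1) * zeta_series (s + of_nat i - 1)))"
    unfolding sum_negf[symmetric]
  proof (rule sum.cong[OF refl])
    fix i assume "i \<in> {2..K}"
    then obtain k where k: "i = Suc k" by (cases i) auto
    show "((1 - s) gchoose i) * zeta_series (s + of_nat i - 1)
        = - (((1 - s) gchoose (i - 1)) / of_nat i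
         * ((s + of_nat i - 1 - 1) * zeta_series (s + of_nat i - 1)))"
    proof -
      have eq: "s + of_nat (Suc k) - 1 = s + of_nat k" by simp
      show ?thesis
        unfolding k gbinomial_Suc_mult eq diff_Suc_1
        by (simp add: divide_inverse algebra_simps del: of_nat_Suc)
    qed
  qed
  finally show ?thesis by (simp add: algebra_simps)
qed

text \<open>
  In \<open>zeta_series_recursion\<close> the shifted arguments on the right have a real part larger by at
  least one, so that the right-hand side continues \<open>(s - 1) \<zeta>(s)\<close> one unit further to the left. At
  \<open>s = 1\<close> and \<open>s = 0\<close> the remainders vanish, as \<open>x\<^bsup>1-s\<^esup>\<close> is then a polynomial of degree at most
  one; this determines the values there.
\<close>
lemma zeta_halfplane_extension:
  "\<exists>\<xi>. \<xi> holomorphic_on {s. Re s > 1 - real K} \<and>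
       (\<forall>s. Re s > 1 \<longrightarrow> \<xi> s = (s - 1) * zeta_series s) \<and>
       (K \<ge> 1 \<longrightarrow> \<xi> 1 = 1) \<and> (K \<ge> 2 \<longrightarrow> \<xi> 0 = 1 / 2)"
proof (induction K)
  case 0
  have "(\<lambda>s. (s - 1) * zeta_series s) holomorphic_on {s. Re s > 1 - real 0}"
    using holomorphic_zeta_series by (auto intro!: holomorphic_intros)
  then show ?case by auto
next
  case (Suc K)
  then obtain \<xi> where hol: "\<xi> holomorphic_on {s. Re s > 1 - real K}"
    and eq: "\<And>s. Re s > 1 \<Longrightarrow> \<xi> s = (s - 1) * zeta_series s"
    and one: "K \<ge> 1 \<Longrightarrow> \<xi> 1 = 1"
    by auto
  define L where "L = Suc K"
  define \<eta> where "\<eta> = (\<lambda>s. 1 + (\<Sum>n. binomial_remainder L n s)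
    - (\<Sum>i=2..L. ((1 - s) gchoose (i - 1)) / of_nat i * \<xi> (s + of_nat i - 1)))"
  have "\<eta> holomorphic_on {s. Re s > 1 - real L}"
  proof -
    have "(\<xi> \<circ> (\<lambda>s. s + of_nat i - 1)) holomorphic_on {s. Re s > 1 - real L}"
      if "i \<in> {2..L}" for i
      by (rule holomorphic_on_compose_gen[OF _ hol]) (use that in \<open>auto intro!: holomorphic_intros simp: L_def\<close>)
    then show ?thesis
      unfolding \<eta>_def gbinomial_prod_rev
      by (intro holomorphic_intros holomorphic_binomial_remainder_series) (auto simp: o_def)
  qed
  moreover have "\<eta> s = (s - 1) * zeta_series s" if "Re s > 1" for s
  proof -
    have "(\<Sum>i=2..L. ((1 - s) gchoose (i - 1)) / of_nat i * \<xi> (s + of_nat i - 1))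
      = (\<Sum>i=2..L. ((1 - s) gchoose (i - 1)) / of_nat i
         * ((s + of_nat i - 1 - 1) * zeta_series (s + of_nat i - 1)))"
      using that by (intro sum.cong refl arg_cong2[where f = "(*)"] eq) auto
    then show ?thesis
      unfolding \<eta>_def using zeta_series_recursion[OF that, of L] by (simp add: L_def)
  qed
  moreover have "\<eta> 1 = 1"
  proof -
    have "binomial_remainder L n 1 = 0" for n
    proof -
      have "(\<Sum>i\<le>L. ((0::complex) gchoose i) * of_nat (Suc n) powr (0 - of_nat i))
        = (\<Sum>i\<in>{0}. ((0::complex) gchoose i) * of_nat (Suc n) powr (0 - of_nat i))"
        by (rule sum.mono_neutral_right) (auto simp: gbinomial_0_left)
      then show ?thesis by (simp add: binomial_remainder_def del: of_nat_Suc)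
    qed
    moreover have "(\<Sum>i=2..L. ((1 - 1 :: complex) gchoose (i - 1)) / of_nat i * \<xi> (1 + of_nat i - 1)) = 0"
      by (rule sum.neutral) (auto simp: gbinomial_0_left)
    ultimately show ?thesis by (simp add: \<eta>_def)
  qed
  moreover have "\<eta> 0 = 1 / 2" if "L \<ge> 2"
  proof -
    have g: "(1::complex) gchoose i = 0" if "i \<ge> 2" for i
      using binomial_gbinomial[of 1 i, where ?'a = complex] binomial_eq_0[of 1 i] that
      by (simp del: One_nat_def)
    have "binomial_remainder L n 0 = 0" for n
    proof -
      have "(\<Sum>i\<le>L. ((1::complex) gchoose i) * of_nat (Suc n) powr (1 - of_nat i))
        = (\<Sum>i\<in>{0,1}. ((1::complex) gchoose i) * of_nat (Suc n) powr (1 - of_nat i))"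
        using that by (intro sum.mono_neutral_right) (auto intro!: g)
      then show ?thesis
        using of_nat_neq_0[of n, where ?'a = complex] by (simp add: binomial_remainder_def)
    qed
    moreover have "(\<Sum>i=2..L. ((1 - 0 :: complex) gchoose (i - 1)) / of_nat i * \<xi> (0 + of_nat i - 1))
        = (\<Sum>i\<in>{2}. ((1 - 0 :: complex) gchoose (i - 1)) / of_nat i * \<xi> (0 + of_nat i - 1))"
      using that by (intro sum.mono_neutral_right) (auto intro!: g)
    ultimately show ?thesis using one that by (simp add: \<eta>_def L_def)
  qed
  ultimately show ?case unfolding L_def[symmetric] by (intro exI[of _ \<eta>]) auto
qed

text \<open>
  The half-plane extensions agree where they overlap, by the identity theorem, so that they glue
  to an entire continuation of \<open>(s - 1) \<zeta>(s)\<close>.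
\<close>
lemma riemann_zeta_exists:
  "\<exists>Z. Z holomorphic_on (- {1}) \<and>
     (\<forall>s. Re s > 1 \<longrightarrow> (\<lambda>k. of_nat (Suc k) powr (- s)) sums Z s) \<and> Z 0 = - 1 / 2"
proof -
  define H where "H = (\<lambda>K. {s. Re s > 1 - real K})"
  have "\<forall>K. \<exists>\<xi>. \<xi> holomorphic_on H K \<and>
       (\<forall>s. Re s > 1 \<longrightarrow> \<xi> s = (s - 1) * zeta_series s) \<and> (K \<ge> 2 \<longrightarrow> \<xi> 0 = 1 / 2)"
    unfolding H_def using zeta_halfplane_extension by blast
  then have "\<exists>\<xi>. \<forall>K. \<xi> K holomorphic_on H K \<and>
       (\<forall>s. Re s > 1 \<longrightarrow> \<xi> K s = (s - 1) * zeta_series s) \<and> (K \<ge> 2 \<longrightarrow> \<xi> K 0 = 1 / 2)"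
    by (rule choice)
  then obtain \<xi> where \<xi>: "\<And>K. \<xi> K holomorphic_on H K"
      "\<And>K s. Re s > 1 \<Longrightarrow> \<xi> K s = (s - 1) * zeta_series s" "\<And>K. K \<ge> 2 \<Longrightarrow> \<xi> K 0 = 1 / 2"
    by auto
  have agree: "\<xi> K s = \<xi> L s" if "s \<in> H K" "K \<le> L" for K L s
  proof (rule analytic_continuation_open[of "{s. Re s > 1}" "H K" "\<xi> K" "\<xi> L"])
    show "connected (H K)"
      unfolding H_def by (intro convex_connected convex_halfspace_Re_gt)
    show "\<xi> L holomorphic_on H K"
      by (rule holomorphic_on_subset[OF \<xi>(1)]) (use that in \<open>auto simp: H_def\<close>)
    have "(2::complex) \<in> {s. Re s > 1}" by simp
    then show "{s. Re s > 1} \<noteq> {}" by blast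
    show "open (H K)" unfolding H_def by (rule open_halfspace_Re_gt)
    show "{s. Re s > 1} \<subseteq> H K" by (auto simp: H_def)
    show "\<xi> K z = \<xi> L z" if "z \<in> {s. Re s > 1}" for z
      using that \<xi>(2) by simp
  qed (rule open_halfspace_Re_gt \<xi>(1) that(1))+
  \<comment> \<open>The summand \<open>2\<close> makes \<open>k s \<ge> 2\<close>, so that the value at \<open>0\<close> is known.\<close>
  define k where "k = (\<lambda>s. nat \<lceil>1 - Re s\<rceil> + 2)"
  have k: "s \<in> H (k s)" for s
    unfolding H_def k_def mem_Collect_eq using of_nat_ceiling[of "1 - Re s"] by simp
  define X where "X = (\<lambda>s. \<xi> (k s) s)"
  have X: "X s = \<xi> K s" if "s \<in> H K" for s K
  proof (cases "K \<le> k s")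
    case True
    then show ?thesis unfolding X_def using agree[OF that True] by simp
  next
    case False
    then have "k s \<le> K" by simp
    then show ?thesis unfolding X_def by (rule agree[OF k])
  qed
  have "X holomorphic_on (\<Union>K. H K)"
  proof (rule holomorphic_on_UN_open)
    show "X holomorphic_on H K" for K
      using \<xi>(1)[of K] X by (simp cong: holomorphic_cong)
    show "open (H K)" for K by (simp add: H_def open_halfspace_Re_gt)
  qed
  moreover have "(\<Union>K. H K) = UNIV" using k by blast
  ultimately have "X holomorphic_on UNIV" by simp
  then have "(\<lambda>s. X s / (s - 1)) holomorphic_on (- {1})"
    by (auto intro!: holomorphic_intros intro: holomorphic_on_subset)
  moreover have "(\<lambda>k. of_nat (Suc k) powr (- s)) sums (X s / (s - 1))" if "Re s > 1" for s
  proof -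
    have "s \<noteq> 1" using that by auto
    then have "X s / (s - 1) = zeta_series s"
      using \<xi>(2)[OF that, of "k s"] by (simp add: X_def)
    then show ?thesis using zeta_series_sums[OF that] by simp
  qed
  moreover have "X 0 / (0 - 1) = - 1 / 2"
    using \<xi>(3)[of "k 0"] by (simp add: X_def k_def)
  ultimately show ?thesis by (intro exI[of _ "\<lambda>s. X s / (s - 1)"]) auto
qed

lemma riemann_zeta_spec:
  "riemann_zeta holomorphic_on (- {1}) \<and>
     (\<forall>s. Re s > 1 \<longrightarrow> (\<lambda>k. of_nat (Suc k) powr (- s)) sums riemann_zeta s)"
proof -
  define P :: "(complex \<Rightarrow> complex) \<Rightarrow> bool" where "P = (\<lambda>Z. Z holomorphic_on (- {1}) \<and>
     (\<forall>s. Re s > 1 \<longrightarrow> (\<lambda>k. of_nat (Suc k) powr (- s)) sums Z s))"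
  have "P (SOME Z. P Z)"
    by (rule someI_ex[of P]) (use riemann_zeta_exists in \<open>auto simp: P_def\<close>)
  then show ?thesis unfolding P_def riemann_zeta_def .
qed

lemma riemann_zeta_eq_series:
  assumes "Re s > 1"
  shows "(\<lambda>k. of_nat (Suc k) powr (- s)) sums riemann_zeta s"
  using riemann_zeta_spec assms by blast

lemma riemann_zeta_0: "riemann_zeta 0 = - 1 / 2"
proof -
  obtain Z where Z: "Z holomorphic_on (- {1})"
    "\<And>s. Re s > 1 \<Longrightarrow> (\<lambda>k. of_nat (Suc k) powr (- s)) sums Z s" "Z 0 = - 1 / 2"
    using riemann_zeta_exists by blast
  have "riemann_zeta 0 = Z 0"
  proof (rule analytic_continuation_open[of "{s. Re s > 1}" "- {1}" riemann_zeta Z])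
    show "connected (- {1} :: complex set)"
      by (intro connected_punctured_universe) simp
    have "(2::complex) \<in> {s. Re s > 1}" by simp
    then show "{s. Re s > 1} \<noteq> {}" by blast
    show "{s. Re s > 1} \<subseteq> - {1 :: complex}" by auto
    show "riemann_zeta holomorphic_on - {1}" using riemann_zeta_spec by blast
    show "riemann_zeta z = Z z" if "z \<in> {s. Re s > 1}" for z
      using that riemann_zeta_spec Z(2)[of z] sums_unique2 by blast
  qed (use Z(1) in \<open>simp_all add: open_halfspace_Re_gt open_Compl\<close>)
  then show ?thesis using Z by simp
qed

lemma Re_riemann_zeta_of_nat:
  assumes "N \<ge> 2"
  shows "(\<lambda>q. 1 / real (Suc q) ^ N) sums Re (riemann_zeta (of_nat N))"
proof -
  have "(\<lambda>k. of_nat (Suc k) powr (- of_nat N)) sums riemann_zeta (of_nat N)"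
    using assms by (intro riemann_zeta_eq_series) auto
  then have "(\<lambda>k. Re (of_nat (Suc k) powr (- of_nat N))) sums Re (riemann_zeta (of_nat N))"
    by (rule sums_Re)
  moreover have "Re (of_nat (Suc k) powr (- of_nat N)) = 1 / real (Suc k) ^ N" for k
  proof -
    have "(of_nat (Suc k) powr (- of_nat N) :: complex) = of_real (1 / real (Suc k) ^ N)"
      using powr_nat'[of "of_nat (Suc k) :: complex" N]
      by (simp add: powr_minus inverse_eq_divide del: of_nat_Suc)
    then show ?thesis by (simp only: Re_complex_of_real)
  qed
  ultimately show ?thesis by simp
qed

section \<open>Smooth functions and division by powers\<close>

lemma iterated_deriv_eq:
  fixes F :: "nat \<Rightarrow> real \<Rightarrow> real"
  assumes "open S" and F: "\<And>k x. x \<in> S \<Longrightarrow> (F k has_real_derivative F (Suc k) x) (at x)"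
    and "x \<in> S"
  shows "(deriv ^^ k) (F 0) x = F k x"
  using \<open>x \<in> S\<close>
proof (induction k arbitrary: x)
  case (Suc k)
  have "((deriv ^^ k) (F 0) has_real_derivative F (Suc k) x) (at x)"
    by (rule has_field_derivative_transform_within_open[OF F[OF Suc.prems] \<open>open S\<close> Suc.prems])
       (use Suc.IH in auto)
  then show ?case by (simp add: DERIV_imp_deriv)
qed simp

lemma smooth_on_open_iff:
  assumes "open S"
  shows "smooth_on S f \<longleftrightarrow>
    (\<forall>k. \<forall>x\<in>S. ((deriv ^^ k) f has_real_derivative (deriv ^^ Suc k) f x) (at x))"
proof
  assume "smooth_on S f"
  then obtain F where F: "F 0 = f" "\<And>k x. x \<in> S \<Longrightarrow> (F k has_real_derivative F (Suc k) x) (at x)"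
    using assms unfolding smooth_on_def by (metis at_within_open)
  have eq: "(deriv ^^ k) f x = F k x" if "x \<in> S" for k x
    using iterated_deriv_eq[where F = F, OF assms F(2) that] F(1) by simp
  show "\<forall>k. \<forall>x\<in>S. ((deriv ^^ k) f has_real_derivative (deriv ^^ Suc k) f x) (at x)"
  proof (intro allI ballI)
    fix k x assume x: "x \<in> S"
    show "((deriv ^^ k) f has_real_derivative (deriv ^^ Suc k) f x) (at x)"
      unfolding eq[OF x]
      by (rule has_field_derivative_transform_within_open[OF F(2)[OF x] assms x]) (simp add: eq)
  qed
next
  assume "\<forall>k. \<forall>x\<in>S. ((deriv ^^ k) f has_real_derivative (deriv ^^ Suc k) f x) (at x)"
  then show "smooth_on S f" unfolding smooth_on_def
    by (intro exI[of _ "\<lambda>k. (deriv ^^ k) f"]) (auto intro: has_field_derivative_at_within)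
qed

lemma smooth_on_cong:
  assumes "smooth_on S f" and "\<And>x. x \<in> S \<Longrightarrow> g x = f x"
  shows "smooth_on S g"
proof -
  obtain F where F: "F 0 = f" "\<And>k x. x \<in> S \<Longrightarrow> (F k has_real_derivative F (Suc k) x) (at x within S)"
    using assms(1) unfolding smooth_on_def by blast
  have "((F(0 := g)) k has_real_derivative (F(0 := g)) (Suc k) x) (at x within S)"
    if x: "x \<in> S" for k x
  proof (cases k)
    case 0
    have "(g has_real_derivative F (Suc 0) x) (at x within S)"
      by (rule has_field_derivative_transform_within[OF F(2)[OF x, of 0] zero_less_one x])
         (use assms(2) F(1) in auto)
    then show ?thesis using 0 by simp
  qed (use F(2)[OF x] in auto)
  then show ?thesis unfolding smooth_on_def by (intro exI[of _ "F(0 := g)"]) auto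
qed

lemma smooth_on_subset:
  assumes "smooth_on S f" and "T \<subseteq> S"
  shows "smooth_on T f"
proof -
  obtain F where F: "F 0 = f" "\<And>k x. x \<in> S \<Longrightarrow> (F k has_real_derivative F (Suc k) x) (at x within S)"
    using assms(1) unfolding smooth_on_def by blast
  then show ?thesis using assms(2) unfolding smooth_on_def
    by (intro exI[of _ F]) (auto intro: has_field_derivative_subset)
qed

lemma smooth_on_diff_sum:
  fixes n :: nat
  assumes "smooth_on S f" and "\<And>k. smooth_on S (g k)"
  shows "smooth_on S (\<lambda>x. f x - (\<Sum>k<n. c k * g k x))"
proof (induction n)
  case (Suc n)
  obtain F where F: "F 0 = (\<lambda>x. f x - (\<Sum>k<n. c k * g k x))"
    "\<And>k x. x \<in> S \<Longrightarrow> (F k has_real_derivative F (Suc k) x) (at x within S)"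
    using Suc unfolding smooth_on_def by blast
  obtain G where G: "G 0 = g n"
    "\<And>k x. x \<in> S \<Longrightarrow> (G k has_real_derivative G (Suc k) x) (at x within S)"
    using assms(2)[of n] unfolding smooth_on_def by blast
  show ?case unfolding smooth_on_def
    by (intro exI[of _ "\<lambda>k x. F k x - c n * G k x"])
       (auto simp: F(1) G(1) fun_eq_iff intro!: derivative_eq_intros F(2) G(2))
qed (use assms in simp)

lemma smooth_on_shift:
  assumes "smooth_on S f" and "open S"
  shows "smooth_on {x. x - c \<in> S} (\<lambda>x. f (x - c))"
proof -
  obtain F where F: "F 0 = f" "\<And>k x. x \<in> S \<Longrightarrow> (F k has_real_derivative F (Suc k) x) (at x)"
    using assms unfolding smooth_on_def by (metis at_within_open)
  have "((\<lambda>x. F k (x - c)) has_real_derivative F (Suc k) (x - c)) (at x)" if "x - c \<in> S" for k x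
    using F(2)[OF that, of k] DERIV_shift[of "F k" "F (Suc k) (x - c)" x "- c"] by simp
  then show ?thesis unfolding smooth_on_def
    by (intro exI[of _ "\<lambda>k x. F k (x - c)"]) (auto simp: F(1) intro: has_field_derivative_at_within)
qed

text \<open>
  Derivatives on different open sets are compatible because they are all given by iterating
  \<^const>\<open>deriv\<close>.
\<close>
lemma smooth_on_UNIV_local:
  assumes "\<And>x. \<exists>U. open U \<and> x \<in> U \<and> smooth_on U f"
  shows "smooth_on UNIV f"
  unfolding smooth_on_open_iff[OF open_UNIV] using assms smooth_on_open_iff by blast

text \<open>
  Hadamard's lemma. The quotient is \<open>\<integral>\<^sub>0\<^sup>1 F'(t + u (x - t)) du\<close>; differentiating under the
  integral sign shows that it is smooth, up to the end points of the interval, and gives its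
  derivatives at \<open>t\<close>.
\<close>
lemma smooth_divide:
  fixes F :: "nat \<Rightarrow> real \<Rightarrow> real"
  assumes F: "\<And>k x. x \<in> {a..b} \<Longrightarrow> (F k has_real_derivative F (Suc k) x) (at x within {a..b})"
    and t: "t \<in> {a..b}"
  obtains G where "\<And>k x. x \<in> {a..b} \<Longrightarrow> (G k has_real_derivative G (Suc k) x) (at x within {a..b})"
    and "\<And>x. x \<in> {a..b} \<Longrightarrow> F 0 x = F 0 t + (x - t) * G 0 x"
    and "\<And>k. G k t = F (Suc k) t / real (Suc k)"
proof
  define G where "G = (\<lambda>k x. integral (cbox 0 1) (\<lambda>u. u ^ k * F (Suc k) (t + u * (x - t))))"
  have seg: "t + u * (x - t) \<in> {a..b}" if "u \<in> {0..1}" "x \<in> {a..b}" for u x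
    using convexD[of "{a..b}" t x "1 - u" u] t that by (simp add: algebra_simps)
  have chain: "((\<lambda>x. F k (t + u * (x - t))) has_real_derivative u * F (Suc k) (t + u * (x - t)))
      (at x within {a..b})" if "u \<in> {0..1}" "x \<in> {a..b}" for k u x
  proof -
    have "((F k \<circ> (\<lambda>x. t + u * (x - t))) has_real_derivative F (Suc k) (t + u * (x - t)) * u)
        (at x within {a..b})"
    proof (rule DERIV_image_chain)
      show "(F k has_real_derivative F (Suc k) (t + u * (x - t)))
          (at (t + u * (x - t)) within (\<lambda>x. t + u * (x - t)) ` {a..b})"
        by (rule has_field_derivative_subset[OF F]) (use seg that in auto)
    qed (auto intro!: derivative_eq_intros)
    then show ?thesis by (simp add: o_def mult.commute)
  qed
  have cont: "continuous_on A (\<lambda>z. F k (t + v z * (w z - t)))"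
    if "continuous_on A v" "continuous_on A w" "v ` A \<subseteq> {0..1}" "w ` A \<subseteq> {a..b}"
    for k and A :: "'z::topological_space set" and v w
  proof (rule continuous_on_compose2[of "{a..b}" "F k"])
    show "continuous_on {a..b} (F k)" by (rule DERIV_continuous_on[OF F])
    show "(\<lambda>z. t + v z * (w z - t)) ` A \<subseteq> {a..b}"
    proof (rule image_subsetI)
      fix z assume "z \<in> A"
      then have "v z \<in> {0..1}" "w z \<in> {a..b}"
        using that(3,4)[unfolded image_subset_iff, rule_format] by simp_all
      then show "t + v z * (w z - t) \<in> {a..b}" by (rule seg)
    qed
  qed (intro continuous_intros that)
  show "(G k has_real_derivative G (Suc k) x) (at x within {a..b})" if x: "x \<in> {a..b}" for k x
    unfolding G_def
  proof (rule leibniz_rule_field_derivative[OF _ _ _ x])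
    fix x u :: real assume "x \<in> {a..b}" "u \<in> cbox 0 1"
    then show "((\<lambda>x. u ^ k * F (Suc k) (t + u * (x - t))) has_real_derivative
        u ^ Suc k * F (Suc (Suc k)) (t + u * (x - t))) (at x within {a..b})"
      using DERIV_cmult[OF chain[of u x "Suc k"], of "u ^ k"] by (simp add: algebra_simps)
  next
    fix x assume "x \<in> {a..b}"
    then show "(\<lambda>u. u ^ k * F (Suc k) (t + u * (x - t))) integrable_on cbox 0 1"
      by (intro integrable_continuous continuous_intros cont) auto
  next
    show "continuous_on ({a..b} \<times> cbox 0 1) (\<lambda>(x, u). u ^ Suc k * F (Suc (Suc k)) (t + u * (x - t)))"
      unfolding split_beta by (intro continuous_intros cont) auto
  qed auto
  show "F 0 x = F 0 t + (x - t) * G 0 x" if x: "x \<in> {a..b}" for x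
  proof -
    have "((\<lambda>u. (x - t) * F (Suc 0) (t + u * (x - t))) has_integral
        F 0 (t + 1 * (x - t)) - F 0 (t + 0 * (x - t))) {0..1}"
    proof (rule fundamental_theorem_of_calculus)
      fix u :: real assume u: "u \<in> {0..1}"
      have "((F 0 \<circ> (\<lambda>u. t + u * (x - t))) has_real_derivative F (Suc 0) (t + u * (x - t)) * (x - t))
          (at u within {0..1})"
      proof (rule DERIV_image_chain)
        show "(F 0 has_real_derivative F (Suc 0) (t + u * (x - t)))
            (at (t + u * (x - t)) within (\<lambda>u. t + u * (x - t)) ` {0..1})"
          by (rule has_field_derivative_subset[OF F]) (use seg u x in auto)
      qed (auto intro!: derivative_eq_intros)
      then show "((\<lambda>u. F 0 (t + u * (x - t))) has_vector_derivative (x - t) * F (Suc 0) (t + u * (x - t)))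
          (at u within {0..1})"
        by (simp add: o_def mult.commute has_real_derivative_iff_has_vector_derivative)
    qed simp
    then have "integral {0..1} (\<lambda>u. (x - t) * F (Suc 0) (t + u * (x - t)))
        = F 0 (t + 1 * (x - t)) - F 0 (t + 0 * (x - t))"
      by (rule integral_unique)
    then show ?thesis by (simp add: G_def)
  qed
  show "G k t = F (Suc k) t / real (Suc k)" for k
  proof -
    have "((\<lambda>u::real. u ^ k) has_integral 1 ^ Suc k / real (Suc k) - 0 ^ Suc k / real (Suc k)) {0..1}"
    proof (rule fundamental_theorem_of_calculus)
      fix u :: real
      have "((\<lambda>u. u ^ Suc k / real (Suc k)) has_real_derivative
          real (Suc k) * u ^ (Suc k - Suc 0) / real (Suc k)) (at u within {0..1})"
        by (rule DERIV_cdivide[OF DERIV_pow])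
      also have "real (Suc k) * u ^ (Suc k - Suc 0) / real (Suc k) = u ^ k"
        by (simp del: of_nat_Suc)
      finally show "((\<lambda>u. u ^ Suc k / real (Suc k)) has_vector_derivative u ^ k) (at u within {0..1})"
        by (simp only: has_real_derivative_iff_has_vector_derivative)
    qed simp
    then have "integral {0..1} (\<lambda>u::real. u ^ k) = 1 / real (Suc k)"
      by (simp add: integral_unique)
    then show ?thesis by (simp add: G_def)
  qed
qed

lemma smooth_taylor_division:
  fixes F :: "nat \<Rightarrow> real \<Rightarrow> real"
  assumes F: "\<And>k x. x \<in> {a..b} \<Longrightarrow> (F k has_real_derivative F (Suc k) x) (at x within {a..b})"
    and t: "t \<in> {a..b}"
  shows "\<exists>\<phi>. smooth_on {a..b} \<phi> \<and> \<phi> t = F m t / fact m \<and>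
    (\<forall>x\<in>{a..b}. F 0 x = (\<Sum>i<m. F i t / fact i * (x - t) ^ i) + (x - t) ^ m * \<phi> x)"
  using F
proof (induction m arbitrary: F)
  case 0
  then show ?case unfolding smooth_on_def by (intro exI[of _ "F 0"]) auto
next
  case (Suc m)
  obtain G where G: "\<And>k x. x \<in> {a..b} \<Longrightarrow> (G k has_real_derivative G (Suc k) x) (at x within {a..b})"
    "\<And>x. x \<in> {a..b} \<Longrightarrow> F 0 x = F 0 t + (x - t) * G 0 x"
    "\<And>k. G k t = F (Suc k) t / real (Suc k)"
    using smooth_divide[where F = F, OF Suc.prems t] by blast
  obtain \<phi> where \<phi>: "smooth_on {a..b} \<phi>" "\<phi> t = G m t / fact m"
    "\<And>x. x \<in> {a..b} \<Longrightarrow> G 0 x = (\<Sum>i<m. G i t / fact i * (x - t) ^ i) + (x - t) ^ m * \<phi> x"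
    using Suc.IH[of G] G(1) by blast
  have coeff: "G i t / fact i = F (Suc i) t / fact (Suc i)" for i
    by (simp add: G(3) field_simps)
  have "F 0 x = (\<Sum>i<Suc m. F i t / fact i * (x - t) ^ i) + (x - t) ^ Suc m * \<phi> x"
    if "x \<in> {a..b}" for x
  proof -
    have "(x - t) * (\<Sum>i<m. G i t / fact i * (x - t) ^ i)
        = (\<Sum>i<m. F (Suc i) t / fact (Suc i) * (x - t) ^ Suc i)"
      unfolding sum_distrib_left coeff by (rule sum.cong) (simp_all only: power_Suc mult_ac)
    then show ?thesis
      unfolding sum.lessThan_Suc_shift G(2)[OF that] \<phi>(3)[OF that] distrib_left
      by (simp only: power_Suc mult.assoc power_0 fact_0 div_by_1 mult_1_right add.assoc)
  qed
  then show ?case using \<phi>(1,2) coeff by (intro exI[of _ \<phi>]) auto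
qed

section \<open>The trapezoidal rule for smooth periodic functions\<close>

lemma periodic_add_int_mult:
  fixes u :: "real \<Rightarrow> 'a"
  assumes per: "\<And>x. u (x + T) = u x"
  shows "u (x + of_int i * T) = u x"
proof (induction i rule: int_induct[where k = 0])
  case (step1 i)
  then show ?case using per[of "x + of_int i * T"] by (simp add: algebra_simps)
next
  case (step2 i)
  then show ?case using per[of "x + of_int (i - 1) * T"] by (simp add: algebra_simps)
qed simp

lemma derivative_periodic:
  fixes F :: "nat \<Rightarrow> real \<Rightarrow> real"
  assumes F: "\<And>k x. (F k has_real_derivative F (Suc k) x) (at x)"
    and per: "\<And>x. F 0 (x + T) = F 0 x"
  shows "F k (x + T) = F k x"
proof (induction k arbitrary: x)
  case (Suc k)
  have "((\<lambda>x. F k (x + T)) has_real_derivative F (Suc k) (x + T)) (at x)"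
    using F[of k "x + T"] by (simp add: DERIV_shift)
  then show ?case using Suc F[of k x] by (auto intro: DERIV_unique)
qed (rule per)

text \<open>
  The derivative of an \<open>h\<close>-periodic function vanishes within a distance \<open>h\<close> of every point, by
  Rolle's theorem. So for \<open>h\<close>-periodic functions each derivative, from the first on, is smaller
  than the next one by a factor \<open>h\<close>.
\<close>
lemma periodic_derivative_bound:
  fixes u :: "real \<Rightarrow> real"
  assumes "h > 0" and u: "\<And>x. (u has_real_derivative v x) (at x)"
    and v: "\<And>x. (v has_real_derivative w x) (at x)" and "\<And>x. u (x + h) = u x" and "\<And>x. \<bar>w x\<bar> \<le> B"
  shows "\<bar>v x\<bar> \<le> h * B"
proof -
  obtain z where z: "x < z" "z < x + h" "v z = 0"
    using Rolle_deriv[of x "x + h" u "\<lambda>z y. v z * y"] assms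
    by (metis DERIV_isCont has_field_derivative_def less_add_same_cancel1 continuous_at_imp_continuous_on mult.right_neutral)
  obtain y where "v z - v x = (z - x) * w y"
    using MVT2[of x z v w] v z by blast
  then have "\<bar>v x\<bar> = (z - x) * \<bar>w y\<bar>"
    using z by (simp add: abs_mult flip: abs_minus_cancel[of "v x"])
  also have "\<dots> \<le> h * B" using z assms by (intro mult_mono) auto
  finally show ?thesis .
qed

text \<open>
  The sum \<open>S(x) = \<Sum>j<n. F(x + j h)\<close> is periodic with the small period \<open>h\<close>, while its derivatives
  are bounded by \<open>n\<close> times those of \<open>F\<close>. Applying \<open>periodic_derivative_bound\<close> \<open>K\<close> times shows that
  \<open>S\<close> is constant up to \<open>O(n h\<^bsup>K+1\<^esup>)\<close>. As \<open>h S\<close> takes the value \<open>\<integral>F\<close> somewhere, by the mean value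
  theorem, \<open>h S(t)\<close> is close to the integral.
\<close>
lemma periodic_trapezoid:
  fixes F :: "nat \<Rightarrow> real \<Rightarrow> real"
  assumes T: "T > 0" and F: "\<And>k x. (F k has_real_derivative F (Suc k) x) (at x)"
    and per: "\<And>x. F 0 (x + T) = F 0 x"
  shows "\<exists>C. \<forall>n\<ge>1. \<bar>(T / real n) * (\<Sum>j<n. F 0 (t + real j * (T / real n)))
            - integral {t..t + T} (F 0)\<bar> \<le> C * (T / real n) ^ K"
proof -
  have contF: "continuous_on A (F k)" for A k
    using F by (meson DERIV_isCont continuous_at_imp_continuous_on)
  have "bounded (F (Suc K) ` {t..t + T})"
    by (intro compact_imp_bounded compact_continuous_image contF) auto
  then obtain B where "\<forall>y\<in>F (Suc K) ` {t..t + T}. norm y \<le> B"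
    unfolding bounded_iff by blast
  then have B_period: "\<bar>F (Suc K) x\<bar> \<le> B" if "x \<in> {t..t + T}" for x
    using that by simp
  have B: "\<bar>F (Suc K) x\<bar> \<le> B" for x
  proof -
    \<comment> \<open>Translate \<open>x\<close> into the period on which the bound is known.\<close>
    define i where "i = - \<lfloor>(x - t) / T\<rfloor>"
    have "of_int \<lfloor>(x - t) / T\<rfloor> * T \<le> x - t" "x - t \<le> (of_int \<lfloor>(x - t) / T\<rfloor> + 1) * T"
      using floor_divide_lower[OF T, of "x - t"] floor_divide_upper[OF T, of "x - t"] by simp_all
    then have "x + of_int i * T \<in> {t..t + T}" by (auto simp: i_def algebra_simps)
    from B_period[OF this] show ?thesis
      using periodic_add_int_mult[of "F (Suc K)" T x i] derivative_periodic[of F T, OF F per] by simp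
  qed
  have B0: "B \<ge> 0" by (rule order.trans[OF abs_ge_zero B[of t]])
  \<comment> \<open>On an interval larger than the period, \<open>Q\<close> is differentiable in the usual sense at \<open>t\<close> and \<open>t + T\<close>.\<close>
  have "\<exists>Q. \<forall>x\<in>{t - 1..t + T + 1}.
      (Q has_vector_derivative F 0 x) (at x within {t - 1..t + T + 1})"
  proof (rule antiderivative_continuous[OF contF[of "{t - 1..t + T + 1}" 0]])
    fix Q assume Q: "\<And>x. x \<in> {t - 1..t + T + 1} \<Longrightarrow>
      (Q has_vector_derivative F 0 x) (at x within {t - 1..t + T + 1})"
    show ?thesis by (intro exI[of _ Q] ballI Q)
  qed
  then obtain Q where Q: "\<forall>x\<in>{t - 1..t + T + 1}.
      (Q has_vector_derivative F 0 x) (at x within {t - 1..t + T + 1})"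
    by (rule exE)
  have Q: "(Q has_real_derivative F 0 x) (at x)" if "x \<in> {t..t + T}" for x
  proof -
    have "x \<in> {t - 1..t + T + 1}" using that by auto
    from Q[rule_format, OF this]
    have "(Q has_real_derivative F 0 x) (at x within {t - 1..t + T + 1})"
      by (simp only: has_real_derivative_iff_has_vector_derivative)
    then have "(Q has_real_derivative F 0 x) (at x within {t - 1<..<t + T + 1})"
      by (rule has_field_derivative_subset) auto
    then show ?thesis using that by (subst (asm) at_within_open) auto
  qed
  have int: "integral {t..t + T} (F 0) = Q (t + T) - Q t"
    by (rule integral_unique, rule fundamental_theorem_of_calculus)
       (use T Q in \<open>auto simp: has_real_derivative_iff_has_vector_derivative[symmetric]
          intro: has_field_derivative_at_within\<close>)
  show ?thesis
  proof (intro exI allI impI)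
    fix n :: nat assume n: "n \<ge> 1"
    define h where "h = T / real n"
    have h: "h > 0" and nh: "real n * h = T" using T n by (auto simp: h_def)
    define S where "S = (\<lambda>k x. \<Sum>j<n. F k (x + real j * h))"
    have S: "(S k has_real_derivative S (Suc k) x) (at x)" for k x
      unfolding S_def using F DERIV_shift by (intro DERIV_sum) blast
    have "S 0 (x + h) = S 0 x" for x
    proof -
      have "S 0 (x + h) - S 0 x = (\<Sum>j<n. F 0 (x + real (Suc j) * h) - F 0 (x + real j * h))"
        by (simp add: S_def sum_subtractf algebra_simps)
      also have "\<dots> = F 0 (x + real n * h) - F 0 (x + real 0 * h)"
        by (rule sum_lessThan_telescope)
      finally show ?thesis by (simp add: nh per)
    qed
    then have Sper: "S k (x + h) = S k x" for k x
      using derivative_periodic[of S h, OF S] by blast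
    have bound: "\<bar>S (Suc (K - i)) x\<bar> \<le> h ^ i * (real n * B)" if "i \<le> K" for i x
      using that
    proof (induction i arbitrary: x)
      case 0
      have "\<bar>S (Suc K) x\<bar> \<le> (\<Sum>j<n. B)"
        unfolding S_def by (intro order.trans[OF sum_abs] sum_mono B)
      then show ?case by simp
    next
      case (Suc i)
      then have "K - i = Suc (K - Suc i)" by simp
      with Suc periodic_derivative_bound[OF h S S Sper, of "K - Suc i" "h ^ i * (real n * B)" x]
      show ?case by (simp add: algebra_simps)
    qed
    obtain z where z: "t < z" "z < t + h" "integral {t..t + T} (F 0) = h * S 0 z"
    proof -
      \<comment> \<open>The increments of \<open>Q\<close> over the cells add up to \<open>\<psi> (t + h) - \<psi> t\<close>.\<close>
      define \<psi> where "\<psi> = (\<lambda>x. \<Sum>j<n. Q (x + real j * h))"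
      have "(\<psi> has_real_derivative S 0 x) (at x)" if "t \<le> x" "x \<le> t + h" for x
      proof -
        have "(Q has_real_derivative F 0 (x + real j * h)) (at (x + real j * h))" if "j < n" for j
        proof (rule Q)
          have "real (Suc j) * h \<le> real n * h" using that h by (intro mult_right_mono) auto
          then have "x + real j * h \<le> t + T"
            using \<open>x \<le> t + h\<close> nh by (simp add: algebra_simps)
          moreover have "0 \<le> real j * h" using h by simp
          ultimately show "x + real j * h \<in> {t..t + T}" using \<open>t \<le> x\<close> by simp
        qed
        then show ?thesis
          unfolding \<psi>_def S_def by (intro DERIV_sum) (simp add: DERIV_shift)
      qed
      then obtain z where z: "t < z" "z < t + h" "\<psi> (t + h) - \<psi> t = (t + h - t) * S 0 z"
        using MVT2[of t "t + h" \<psi> "S 0"] h by auto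
      have "\<psi> (t + h) - \<psi> t = (\<Sum>j<n. Q (t + real (Suc j) * h) - Q (t + real j * h))"
        by (simp add: \<psi>_def sum_subtractf algebra_simps)
      also have "\<dots> = Q (t + real n * h) - Q (t + real 0 * h)"
        by (rule sum_lessThan_telescope)
      finally show ?thesis using that z nh int by simp
    qed
    obtain y where y: "S 0 z - S 0 t = (z - t) * S 1 y"
      using MVT2[of t z "S 0" "S 1"] S z by (metis One_nat_def)
    have "\<bar>S 0 t - S 0 z\<bar> = \<bar>S 0 z - S 0 t\<bar>" by (rule abs_minus_commute)
    also have "\<dots> = (z - t) * \<bar>S 1 y\<bar>"
      unfolding y abs_mult using z by simp
    also have "\<dots> \<le> h * (h ^ K * (real n * B))"
      using z bound[of K y] by (intro mult_mono) auto
    also have "\<dots> = T * B * h ^ K" using nh by (simp add: algebra_simps)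
    finally have "h * \<bar>S 0 t - S 0 z\<bar> \<le> h * (T * B * h ^ K)"
      using h by (intro mult_left_mono) auto
    \<comment> \<open>The remaining factor \<open>h\<close> is bounded by \<open>T\<close>, as \<open>n \<ge> 1\<close>.\<close>
    also have "\<dots> \<le> T * (T * B * h ^ K)"
    proof -
      have "1 * h \<le> real n * h" using n h by (intro mult_right_mono) auto
      then show ?thesis using nh T B0 h by (intro mult_right_mono) auto
    qed
    also have "h * \<bar>S 0 t - S 0 z\<bar> = \<bar>h * S 0 t - h * S 0 z\<bar>"
      using h by (simp add: abs_mult flip: right_diff_distrib)
    finally show "\<bar>(T / real n) * (\<Sum>j<n. F 0 (t + real j * (T / real n)))
            - integral {t..t + T} (F 0)\<bar> \<le> (T * (T * B)) * (T / real n) ^ K"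
      using z(3) by (simp add: S_def h_def algebra_simps)
  qed
qed

section \<open>Periodic functions with a single pole per period\<close>

text \<open>
  The function \<open>\<Sum>l\<in>\<int>. (x + l)\<^bsup>-(n+1)\<^esup>\<close>, with the two halves of the sum expressed by polygamma
  functions. For \<open>n = 0\<close>, where the series has to be summed symmetrically, this is the reflection
  formula for \<open>\<pi> cot (\<pi> x)\<close>.
\<close>
definition pole_kernel :: "nat \<Rightarrow> real \<Rightarrow> real" where
  "pole_kernel n x = (-1) ^ Suc n / fact n * (Polygamma n x - (-1) ^ n * Polygamma n (1 - x))"

text \<open>
  The same sum without the term \<open>l = 0\<close>, which makes it smooth on the open interval from \<open>- 1\<close> to
  \<open>1\<close>.
\<close>
definition pole_kernel_regular :: "nat \<Rightarrow> real \<Rightarrow> real" where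
  "pole_kernel_regular n x =
     (-1) ^ Suc n / fact n * (Polygamma n (1 + x) - (-1) ^ n * Polygamma n (1 - x))"

lemma minus1_power_cancel: "(-1) ^ n * ((-1) ^ n * x) = (x :: real)"
  by (simp flip: mult.assoc power_add)

lemma pole_kernel_eq:
  assumes "x \<noteq> 0"
  shows "pole_kernel n x = 1 / x ^ Suc n + pole_kernel_regular n x"
proof -
  have "Polygamma n x = Polygamma n (1 + x) - (-1) ^ n * fact n / x ^ Suc n"
    using Polygamma_plus1[OF assms, of n] by (simp add: add.commute)
  then have "pole_kernel n x = pole_kernel_regular n x
      - (-1) ^ Suc n / fact n * ((-1) ^ n * fact n / x ^ Suc n)"
    unfolding pole_kernel_def pole_kernel_regular_def
    by (simp only: right_diff_distrib diff_right_commute)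
  also have "(-1) ^ Suc n / fact n * ((-1) ^ n * fact n / x ^ Suc n) = - (1 / x ^ Suc n)"
    by (simp add: minus1_power_cancel)
  finally show ?thesis by simp
qed

lemma pole_kernel_periodic:
  assumes "x \<notin> \<int>"
  shows "pole_kernel n (x + 1) = pole_kernel n x"
proof -
  have x: "x \<noteq> 0" using assms by auto
  have "Polygamma n (x + 1) = Polygamma n x + (-1) ^ n * fact n / x ^ Suc n"
    by (rule Polygamma_plus1[OF x])
  moreover have "Polygamma n (1 - x) = Polygamma n (1 - (x + 1)) - fact n / x ^ Suc n"
    using Polygamma_plus1[of "- x" n] x
    by (simp add: power_minus[of x] minus1_power_cancel[of n] add.commute divide_simps mult_ac)
  then have "Polygamma n (1 - (x + 1)) = Polygamma n (1 - x) + fact n / x ^ Suc n"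
    by simp
  ultimately show ?thesis
    unfolding pole_kernel_def by (simp only: algebra_simps) simp
qed

lemma pole_kernel_reflect: "pole_kernel n (1 - x) = (-1) ^ Suc n * pole_kernel n x"
  unfolding pole_kernel_def by (simp add: algebra_simps minus1_power_cancel)

lemma DERIV_pole_kernel:
  assumes "x \<notin> \<int>"
  shows "(pole_kernel n has_real_derivative - real (Suc n) * pole_kernel (Suc n) x) (at x)"
proof -
  have *: "x \<notin> \<int>\<^sub>\<le>\<^sub>0" "1 - x \<notin> \<int>\<^sub>\<le>\<^sub>0"
    using assms nonpos_Ints_Int Ints_diff[of 1 "1 - x"] by (auto simp: dest: nonpos_Ints_Int)
  have "(pole_kernel n has_real_derivative
      (-1) ^ Suc n / fact n * (Polygamma (Suc n) x + (-1) ^ n * Polygamma (Suc n) (1 - x))) (at x)"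
    unfolding pole_kernel_def[abs_def] using *
    by (auto intro!: derivative_eq_intros)
  also have "(-1) ^ Suc n / fact n * (Polygamma (Suc n) x + (-1) ^ n * Polygamma (Suc n) (1 - x))
      = - real (Suc n) * pole_kernel (Suc n) x"
    by (simp add: pole_kernel_def divide_simps del: of_nat_Suc)
  finally show ?thesis .
qed

lemma DERIV_pole_kernel_regular:
  assumes "\<bar>x\<bar> < 1"
  shows "(pole_kernel_regular n has_real_derivative
    - real (Suc n) * pole_kernel_regular (Suc n) x) (at x)"
proof -
  have *: "1 + x \<notin> \<int>\<^sub>\<le>\<^sub>0" "1 - x \<notin> \<int>\<^sub>\<le>\<^sub>0"
    using assms by (auto elim!: nonpos_Ints_cases)
  have "(pole_kernel_regular n has_real_derivative
      (-1) ^ Suc n / fact n * (Polygamma (Suc n) (1 + x) + (-1) ^ n * Polygamma (Suc n) (1 - x))) (at x)"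
    unfolding pole_kernel_regular_def[abs_def] using *
    by (auto intro!: derivative_eq_intros)
  also have "(-1) ^ Suc n / fact n * (Polygamma (Suc n) (1 + x) + (-1) ^ n * Polygamma (Suc n) (1 - x))
      = - real (Suc n) * pole_kernel_regular (Suc n) x"
    by (simp add: pole_kernel_regular_def divide_simps del: of_nat_Suc)
  finally show ?thesis .
qed

lemma Polygamma_odd_sums:
  assumes "odd n" and "x > 0"
  shows "(\<lambda>l. 1 / (x + real l) ^ Suc n) sums (Polygamma n x / fact n)"
proof -
  have "n > 0" using assms(1) by (cases n) auto
  then show ?thesis
    using Polygamma_LIMSEQ[of x n] assms by (simp add: inverse_eq_divide)
qed

lemma pole_kernel_regular_0_even:
  assumes "even n"
  shows "pole_kernel_regular n 0 = 0"
  using assms by (simp add: pole_kernel_regular_def)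

text \<open>
  At \<open>0\<close> the terms \<open>l\<close> and \<open>- l\<close> agree if the exponent \<open>n + 1\<close> is even. The hypothesis says
  \<open>z = \<zeta>(n + 1)\<close>.
\<close>
lemma pole_kernel_regular_0_odd:
  assumes "odd n" and z: "(\<lambda>q. 1 / real (Suc q) ^ Suc n) sums z"
  shows "pole_kernel_regular n 0 = 2 * z"
proof -
  have "Polygamma n 1 / fact n = z"
    using sums_unique2[OF Polygamma_odd_sums[OF assms(1), of 1] ] z by (simp add: add.commute)
  then show ?thesis using assms(1) by (simp add: pole_kernel_regular_def)
qed

text \<open>
  The kernel is odd about \<open>1 / 2\<close>, so that the nodes \<open>j\<close> and \<open>n - j\<close> cancel.
\<close>
lemma sum_pole_kernel_even:
  assumes "even k"
  shows "(\<Sum>j=1..<n. pole_kernel k (real j / real n)) = 0"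
proof -
  let ?S = "\<Sum>j=1..<n. pole_kernel k (real j / real n)"
  have "?S = (\<Sum>j=1..<n. pole_kernel k (real (n - j) / real n))"
    by (rule sum.reindex_bij_witness[of _ "\<lambda>j. n - j" "\<lambda>j. n - j"]) auto
  also have "\<dots> = (\<Sum>j=1..<n. - pole_kernel k (real j / real n))"
  proof (rule sum.cong[OF refl])
    fix j assume "j \<in> {1..<n}"
    then have "real (n - j) / real n = 1 - real j / real n"
      by (simp add: of_nat_diff diff_divide_distrib)
    then show "pole_kernel k (real (n - j) / real n) = - pole_kernel k (real j / real n)"
      using assms by (simp add: pole_kernel_reflect)
  qed
  finally show ?thesis by (simp add: sum_negf)
qed

text \<open>
  The points \<open>j / n + l\<close> with \<open>1 \<le> j \<le> n\<close> and \<open>l \<ge> 0\<close> are all positive multiples of \<open>1 / n\<close>, so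
  their inverse powers add up to \<open>n\<^bsup>k+1\<^esup> \<zeta>(k + 1)\<close>; the points with \<open>j = n\<close> contribute \<open>\<zeta>(k + 1)\<close>
  to this. The other half of the kernel gives the same by reflection. Here \<open>z = \<zeta>(k + 1)\<close>.
\<close>
lemma sum_pole_kernel_odd:
  assumes k: "odd k" and z: "(\<lambda>q. 1 / real (Suc q) ^ Suc k) sums z" and n: "n \<ge> 1"
  shows "(\<Sum>j=1..<n. pole_kernel k (real j / real n)) = 2 * z * (real n ^ Suc k - 1)"
proof -
  let ?P = "\<lambda>j. Polygamma k (real j / real n) / fact k"
  have "(\<lambda>l. \<Sum>j=1..n. 1 / (real j / real n + real l) ^ Suc k) sums (\<Sum>j=1..n. ?P j)"
    by (intro sums_sum Polygamma_odd_sums k) (use n in auto)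
  moreover have "(\<Sum>j=1..n. 1 / (real j / real n + real l) ^ Suc k)
      = real n ^ Suc k * (\<Sum>q\<in>{l * n..<l * n + n}. 1 / real (Suc q) ^ Suc k)" for l
  proof -
    have "(\<Sum>j=1..n. 1 / (real j / real n + real l) ^ Suc k)
        = (\<Sum>q\<in>{l * n..<l * n + n}. 1 / (real (Suc q - l * n) / real n + real l) ^ Suc k)"
      by (rule sum.reindex_bij_witness[of _ "\<lambda>q. Suc q - l * n" "\<lambda>j. j + l * n - 1"]) auto
    also have "\<dots> = (\<Sum>q\<in>{l * n..<l * n + n}. real n ^ Suc k * (1 / real (Suc q) ^ Suc k))"
    proof (rule sum.cong[OF refl])
      fix q assume "q \<in> {l * n..<l * n + n}"
      then have "real (Suc q - l * n) / real n + real l = real (Suc q) / real n"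
        using n by (simp add: of_nat_diff field_simps)
      then show "1 / (real (Suc q - l * n) / real n + real l) ^ Suc k
          = real n ^ Suc k * (1 / real (Suc q) ^ Suc k)"
        by (simp only: power_divide) simp
    qed
    finally show ?thesis by (simp only: sum_distrib_left)
  qed
  moreover have "(\<lambda>l. real n ^ Suc k * (\<Sum>q\<in>{l * n..<l * n + n}. 1 / real (Suc q) ^ Suc k))
      sums (real n ^ Suc k * z)"
    by (intro sums_mult sums_group[OF z]) (use n in auto)
  ultimately have "(\<Sum>j=1..n. ?P j) = real n ^ Suc k * z"
    using sums_unique2 by simp
  moreover have "?P n = z"
    using sums_unique2[OF Polygamma_odd_sums[OF k, of 1]] z n by (simp add: add.commute)
  moreover have "{1..n} = insert n {1..<n}" using n by auto
  ultimately have 1: "(\<Sum>j=1..<n. ?P j) = z * (real n ^ Suc k - 1)"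
    by (simp add: algebra_simps)
  have "(\<Sum>j=1..<n. ?P (n - j)) = (\<Sum>j=1..<n. ?P j)"
    by (rule sum.reindex_bij_witness[of _ "\<lambda>j. n - j" "\<lambda>j. n - j"]) auto
  moreover have "pole_kernel k (real j / real n) = ?P j + ?P (n - j)" if "j \<in> {1..<n}" for j
  proof -
    have "real (n - j) / real n = 1 - real j / real n"
      using that by (simp add: of_nat_diff diff_divide_distrib)
    then show ?thesis using k by (simp add: pole_kernel_def add_divide_distrib)
  qed
  ultimately show ?thesis using 1 by (simp add: sum.distrib)
qed

definition scaled_kernel :: "real \<Rightarrow> real \<Rightarrow> nat \<Rightarrow> real \<Rightarrow> real" where
  "scaled_kernel T t n x = pole_kernel n ((x - t) / T) / T ^ Suc n"

definition scaled_kernel_regular :: "real \<Rightarrow> real \<Rightarrow> nat \<Rightarrow> real \<Rightarrow> real" where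
  "scaled_kernel_regular T t n x = pole_kernel_regular n ((x - t) / T) / T ^ Suc n"

lemma DERIV_scaled_kernel:
  assumes "T \<noteq> 0" and "(x - t) / T \<notin> \<int>"
  shows "(scaled_kernel T t n has_real_derivative - real (Suc n) * scaled_kernel T t (Suc n) x) (at x)"
  unfolding scaled_kernel_def[abs_def] using assms
  by (auto intro!: derivative_eq_intros DERIV_chain2[OF DERIV_pole_kernel] simp del: of_nat_Suc)

lemma DERIV_scaled_kernel_regular:
  assumes "T > 0" and "\<bar>x - t\<bar> < T"
  shows "(scaled_kernel_regular T t n has_real_derivative
    - real (Suc n) * scaled_kernel_regular T t (Suc n) x) (at x)"
  unfolding scaled_kernel_regular_def[abs_def] using assms
  by (auto intro!: derivative_eq_intros DERIV_chain2[OF DERIV_pole_kernel_regular] simp del: of_nat_Suc)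

lemma scaled_kernel_eq:
  assumes "T \<noteq> 0" and "x \<noteq> t"
  shows "scaled_kernel T t n x = 1 / (x - t) ^ Suc n + scaled_kernel_regular T t n x"
  unfolding scaled_kernel_def scaled_kernel_regular_def
  using assms by (simp add: pole_kernel_eq power_divide add_divide_distrib)

lemma scaled_kernel_periodic:
  assumes "T \<noteq> 0" and "(x - t) / T \<notin> \<int>"
  shows "scaled_kernel T t n (x + T) = scaled_kernel T t n x"
proof -
  have "(x + T - t) / T = (x - t) / T + 1" using assms by (simp add: field_simps)
  then show ?thesis using assms by (simp add: scaled_kernel_def pole_kernel_periodic)
qed

lemma scaled_kernel_reflect:
  assumes "T \<noteq> 0"
  shows "scaled_kernel T t n (t + T - e) = (-1) ^ Suc n * scaled_kernel T t n (t + e)"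
proof -
  have "(t + T - e - t) / T = 1 - (t + e - t) / T" using assms by (simp add: field_simps)
  then show ?thesis by (simp only: scaled_kernel_def pole_kernel_reflect) simp
qed

text \<open>
  For \<open>n > 0\<close> an antiderivative is \<open>- K\<^sub>n\<^sub>-\<^sub>1 / n\<close>; by reflection its values at both ends combine
  to the divergent term \<open>(1 - (-1)\<^sup>n) / (n e\<^sup>n)\<close> and a multiple of the regular part, which
  vanishes at \<open>t\<close> whenever the factor \<open>1 - (-1)\<^sup>n\<close> does not. For \<open>n = 0\<close> the antiderivative is the
  logarithm of the sine, up to a constant, in the form \<open>- ln \<Gamma>(y) - ln \<Gamma>(1 - y)\<close> of the reflection
  formula, and the integral is zero by symmetry; the subtracted term is then \<open>0 / 0 = 0\<close>.
\<close>
lemma tendsto_integral_scaled_kernel: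
  assumes T: "T > 0"
  shows "((\<lambda>e. integral {t + e..t + T - e} (scaled_kernel T t n)
             - (1 - (-1) ^ n) / (real n * e ^ n)) \<longlongrightarrow> 0) (at_right 0)"
proof -
  have range: "eventually (\<lambda>e. e \<in> {0<..<T / 2}) (at_right (0::real))"
    using T by (intro eventually_at_right_real) auto
  have notint: "(x - t) / T \<notin> \<int>" if "t < x" "x < t + T" for x
  proof
    assume "(x - t) / T \<in> \<int>"
    then obtain k where k: "(x - t) / T = of_int k" by (elim Ints_cases)
    have "0 < (x - t) / T" "(x - t) / T < 1" using that T by (simp_all add: divide_less_eq)
    then show False unfolding k by simp
  qed
  show ?thesis
  proof (cases n)
    case 0
    define L where "L = (\<lambda>x. - (ln_Gamma ((x - t) / T) + ln_Gamma (1 - (x - t) / T)))"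
    have L: "(L has_real_derivative scaled_kernel T t 0 x) (at x)" if "t < x" "x < t + T" for x
    proof -
      have "(x - t) / T > 0" "1 - (x - t) / T > 0" using that T by (auto simp: field_simps)
      then show ?thesis unfolding L_def scaled_kernel_def pole_kernel_def using T
        by (auto intro!: derivative_eq_intros simp: field_simps)
    qed
    have "integral {t + e..t + T - e} (scaled_kernel T t 0) = 0" if e: "e \<in> {0<..<T / 2}" for e
    proof -
      have "(scaled_kernel T t 0 has_integral L (t + T - e) - L (t + e)) {t + e..t + T - e}"
        by (rule fundamental_theorem_of_calculus)
           (use e in \<open>auto simp: has_real_derivative_iff_has_vector_derivative[symmetric]
              intro!: has_field_derivative_at_within[OF L]\<close>)
      moreover have "L (t + T - e) = L (t + e)"
      proof -
        have "(t + T - e - t) / T = 1 - (t + e - t) / T" using T by (simp add: field_simps)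
        then show ?thesis unfolding L_def by simp
      qed
      ultimately show ?thesis by (simp add: integral_unique)
    qed
    then show ?thesis
      using eventually_mono[OF range] 0 by (intro tendsto_eventually) force
  next
    case (Suc k)
    let ?D = "\<lambda>e. (1 - (-1) ^ n) / real n * scaled_kernel_regular T t k (t + e)"
    have "integral {t + e..t + T - e} (scaled_kernel T t n)
          = (1 - (-1) ^ n) / (real n * e ^ n) + ?D e" if e: "e \<in> {0<..<T / 2}" for e
    proof -
      have "(scaled_kernel T t n has_integral
          - scaled_kernel T t k (t + T - e) / real n - - scaled_kernel T t k (t + e) / real n)
          {t + e..t + T - e}"
      proof (rule fundamental_theorem_of_calculus)
        fix x assume x: "x \<in> {t + e..t + T - e}"
        have "((\<lambda>x. - scaled_kernel T t k x / real n) has_real_derivative scaled_kernel T t n x) (at x)"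
          using DERIV_cdivide[OF DERIV_minus[OF DERIV_scaled_kernel[of T x t k]], of "real n"]
            notint[of x] x e T by (simp add: Suc del: of_nat_Suc)
        then show "((\<lambda>x. - scaled_kernel T t k x / real n) has_vector_derivative scaled_kernel T t n x)
            (at x within {t + e..t + T - e})"
          unfolding has_real_derivative_iff_has_vector_derivative[symmetric]
          by (rule has_field_derivative_at_within)
      qed (use e in auto)
      then have "integral {t + e..t + T - e} (scaled_kernel T t n)
          = - scaled_kernel T t k (t + T - e) / real n - - scaled_kernel T t k (t + e) / real n"
        by (rule integral_unique)
      also have "scaled_kernel T t k (t + T - e) = (-1) ^ n * scaled_kernel T t k (t + e)"
        using T by (simp add: scaled_kernel_reflect Suc)
      also have "- ((-1) ^ n * scaled_kernel T t k (t + e)) / real n - - scaled_kernel T t k (t + e) / real n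
          = (1 - (-1) ^ n) / real n * scaled_kernel T t k (t + e)"
        by (simp add: diff_divide_distrib left_diff_distrib)
      also have "scaled_kernel T t k (t + e) = 1 / e ^ n + scaled_kernel_regular T t k (t + e)"
        using scaled_kernel_eq[of T "t + e" t k] T e by (simp add: Suc)
      finally show ?thesis by (simp add: distrib_left)
    qed
    then have "eventually (\<lambda>e. ?D e = integral {t + e..t + T - e} (scaled_kernel T t n)
             - (1 - (-1) ^ n) / (real n * e ^ n)) (at_right 0)"
      using eventually_mono[OF range] by force
    moreover have "(?D \<longlongrightarrow> 0) (at_right 0)"
    proof -
      have "isCont (scaled_kernel_regular T t k) t"
        using DERIV_isCont[OF DERIV_scaled_kernel_regular[OF T, of t t k]] T by simp
      then have "((\<lambda>e. scaled_kernel_regular T t k (t + e)) \<longlongrightarrow> scaled_kernel_regular T t k t) (at_right 0)"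
        unfolding isCont_iff filterlim_at_split by blast
      then have "(?D \<longlongrightarrow> (1 - (-1) ^ n) / real n * scaled_kernel_regular T t k t) (at_right 0)"
        by (intro tendsto_intros)
      moreover have "(1 - (-1) ^ n) / real n * scaled_kernel_regular T t k t = 0"
        by (cases "even k") (auto simp: Suc scaled_kernel_regular_def pole_kernel_regular_0_even)
      ultimately show ?thesis by (simp only:)
    qed
    ultimately show ?thesis by (rule Lim_transform_eventually[rotated])
  qed
qed

section \<open>Splitting off the poles\<close>

text \<open>
  Covers both the kernels and their regular parts, which satisfy the same rule for derivatives on
  different sets.
\<close>
lemma smooth_on_derivative_ladder:
  fixes E :: "nat \<Rightarrow> real \<Rightarrow> real"
  assumes "\<And>n x. x \<in> S \<Longrightarrow> (E n has_real_derivative - real (Suc n) * E (Suc n) x) (at x)"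
  shows "smooth_on S (E n)"
proof -
  let ?F = "\<lambda>k x. (\<Prod>j<k. - real (Suc (n + j))) * E (n + k) x"
  have "(?F k has_real_derivative ?F (Suc k) x) (at x within S)" if "x \<in> S" for k x
    using DERIV_cmult[OF has_field_derivative_at_within[OF assms[OF that, of "n + k"], of S],
        of "\<Prod>j<k. - real (Suc (n + j))"]
    by (simp add: mult.assoc del: of_nat_Suc)
  then show ?thesis unfolding smooth_on_def by (intro exI[of _ ?F]) auto
qed

lemma Ints_add_1_iff: "(x :: real) + 1 \<in> \<int> \<longleftrightarrow> x \<in> \<int>"
  by (metis Ints_1 Ints_add Ints_diff add_diff_cancel)

lemma divide_period_not_Ints:
  fixes x t T :: real
  assumes "\<bar>x - t\<bar> < T" and "x \<noteq> t"
  shows "(x - t) / T \<notin> \<int>"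
proof
  assume "(x - t) / T \<in> \<int>"
  then obtain k where k: "(x - t) / T = of_int k" by (elim Ints_cases)
  have "T > 0" using assms(1) by linarith
  then have "\<bar>(x - t) / T\<bar> < 1" using assms(1) by simp
  then have "\<bar>of_int k :: real\<bar> < 1" unfolding k .
  then have "k = 0" by linarith
  then show False using k assms by simp
qed

text \<open>
  Away from the poles \<open>R = f - \<Sum> c\<^sub>n K\<^sub>n\<close> is smooth because \<open>f\<close> and the kernels are. Near \<open>t\<close> the
  powers of \<open>(x - t)\<^bsup>-1\<^esup>\<close> cancel, leaving the quotient of \<open>g\<close> minus its Taylor polynomial by
  \<open>(x - t)\<^sup>m\<close>, which is smooth by \<open>smooth_taylor_division\<close>, minus the regular parts of the
  kernels. The other poles are translates of \<open>t\<close>.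
\<close>
lemma smooth_periodic_remainder:
  fixes F :: "nat \<Rightarrow> real \<Rightarrow> real"
  assumes ab: "a < t" "t < b" "T = b - a"
    and F: "\<And>k x. x \<in> {a..b} \<Longrightarrow> (F k has_real_derivative F (Suc k) x) (at x within {a..b})"
    and S: "S = {x. (x - t) / T \<notin> \<int>}"
    and per: "\<And>x. x \<in> S \<Longrightarrow> f (x + T) = f x" and f: "smooth_on S f"
    and fF: "\<And>x. x \<in> {a..b} - {t} \<Longrightarrow> f x = F 0 x / (x - t) ^ m"
    and c: "c = (\<lambda>n. F (m - Suc n) t / fact (m - Suc n))"
  obtains R where "smooth_on UNIV R" and "\<And>x. R (x + T) = R x"
    and "\<And>x. x \<in> S \<Longrightarrow> f x = (\<Sum>n<m. c n * scaled_kernel T t n x) + R x"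
    and "R t = F m t / fact m - (\<Sum>n<m. c n * scaled_kernel_regular T t n t)"
proof
  have T: "T > 0" using ab by simp
  have shift: "x + T \<in> S \<longleftrightarrow> x \<in> S" for x
  proof -
    have "(x + T - t) / T = (x - t) / T + 1" using T by (simp add: field_simps)
    then show ?thesis unfolding S using Ints_add_1_iff by simp
  qed
  define r where "r = F m t / fact m - (\<Sum>n<m. c n * scaled_kernel_regular T t n t)"
  define R where "R = (\<lambda>x. if x \<in> S then f x - (\<Sum>n<m. c n * scaled_kernel T t n x) else r)"
  show per_R: "R (x + T) = R x" for x
  proof (cases "x \<in> S")
    case True
    then have "scaled_kernel T t n (x + T) = scaled_kernel T t n x" for n
      using T by (intro scaled_kernel_periodic) (auto simp: S)
    then show ?thesis using True by (simp add: R_def shift per)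
  qed (simp add: R_def shift)
  show "f x = (\<Sum>n<m. c n * scaled_kernel T t n x) + R x" if "x \<in> S" for x
    using that by (simp add: R_def)
  have "t \<notin> S" by (simp add: S)
  then show "R t = F m t / fact m - (\<Sum>n<m. c n * scaled_kernel_regular T t n t)"
    by (simp add: R_def r_def)
  have "continuous_on UNIV (\<lambda>x. (x - t) / T)" using T by (intro continuous_intros) auto
  then have open_S: "open S"
    unfolding S using open_vimage[of "- \<int>" "\<lambda>x. (x - t) / T"] by (simp add: vimage_def open_Compl)
  have smooth_S: "smooth_on S R"
  proof (rule smooth_on_cong)
    show "smooth_on S (\<lambda>x. f x - (\<Sum>n<m. c n * scaled_kernel T t n x))"
      using T by (intro smooth_on_diff_sum f smooth_on_derivative_ladder DERIV_scaled_kernel)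
        (auto simp: S)
  qed (simp add: R_def)
  define U where "U = {a<..<b}"
  obtain \<phi> where \<phi>: "smooth_on {a..b} \<phi>" "\<phi> t = F m t / fact m"
    "\<And>x. x \<in> {a..b} \<Longrightarrow> F 0 x = (\<Sum>i<m. F i t / fact i * (x - t) ^ i) + (x - t) ^ m * \<phi> x"
    using smooth_taylor_division[where F = F and m = m and t = t, OF F] ab by force
  have smooth_U: "smooth_on U R"
  proof (rule smooth_on_cong)
    have "\<bar>x - t\<bar> < T" if "x \<in> U" for x using that ab by (auto simp: U_def)
    then show "smooth_on U (\<lambda>x. \<phi> x - (\<Sum>n<m. c n * scaled_kernel_regular T t n x))"
      using T by (intro smooth_on_diff_sum smooth_on_derivative_ladder DERIV_scaled_kernel_regular
          smooth_on_subset[OF \<phi>(1)]) (auto simp: U_def)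
    fix x assume x: "x \<in> U"
    show "R x = \<phi> x - (\<Sum>n<m. c n * scaled_kernel_regular T t n x)"
    proof (cases "x = t")
      case True
      then show ?thesis using \<open>t \<notin> S\<close> \<phi>(2) by (simp add: R_def r_def)
    next
      case False
      have "\<bar>x - t\<bar> < T" using x ab by (auto simp: U_def)
      then have "x \<in> S" using divide_period_not_Ints[OF _ False] by (simp add: S)
      have "f x = ((\<Sum>i<m. F i t / fact i * (x - t) ^ i) + (x - t) ^ m * \<phi> x) / (x - t) ^ m"
        using fF[of x] \<phi>(3)[of x] x False by (simp add: U_def)
      also have "\<dots> = (\<Sum>i<m. F i t / fact i * (x - t) ^ i / (x - t) ^ m) + \<phi> x"
        using False by (simp add: add_divide_distrib sum_divide_distrib)
      also have "(\<Sum>i<m. F i t / fact i * (x - t) ^ i / (x - t) ^ m)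
          = (\<Sum>n<m. F (m - Suc n) t / fact (m - Suc n) * (x - t) ^ (m - Suc n) / (x - t) ^ m)"
        by (rule sum.nat_diff_reindex[symmetric])
      also have "\<dots> = (\<Sum>n<m. c n * (1 / (x - t) ^ Suc n))"
      proof (rule sum.cong[OF refl])
        fix n assume "n \<in> {..<m}"
        then have "(x - t) ^ m = (x - t) ^ (m - Suc n) * (x - t) ^ Suc n"
          by (simp only: power_add[symmetric]) simp
        then show "F (m - Suc n) t / fact (m - Suc n) * (x - t) ^ (m - Suc n) / (x - t) ^ m
            = c n * (1 / (x - t) ^ Suc n)"
          using False by (simp add: c)
      qed
      finally have "f x = (\<Sum>n<m. c n * (1 / (x - t) ^ Suc n)) + \<phi> x" .
      moreover have "(\<Sum>n<m. c n * scaled_kernel T t n x)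
          = (\<Sum>n<m. c n * (1 / (x - t) ^ Suc n)) + (\<Sum>n<m. c n * scaled_kernel_regular T t n x)"
        unfolding scaled_kernel_eq[OF less_imp_neq[OF T, symmetric] False]
        by (simp only: distrib_left sum.distrib)
      ultimately show ?thesis using \<open>x \<in> S\<close> by (simp add: R_def)
    qed
  qed
  show "smooth_on UNIV R"
  proof (rule smooth_on_UNIV_local)
    fix x
    show "\<exists>V. open V \<and> x \<in> V \<and> smooth_on V R"
    proof (cases "x \<in> S")
      case True
      then show ?thesis using open_S smooth_S by blast
    next
      case False
      then obtain k where "(x - t) / T = of_int k" by (auto simp: S elim: Ints_cases)
      then have k: "x - of_int k * T = t" using T by (simp add: field_simps)
      have "smooth_on {y. y - of_int k * T \<in> U} (\<lambda>y. R (y - of_int k * T))"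
        by (rule smooth_on_shift[OF smooth_U]) (simp add: U_def)
      moreover have "R (y - of_int k * T) = R y" for y
        using periodic_add_int_mult[of R T y "- k", OF per_R] by simp
      moreover have "{y. y - of_int k * T \<in> U} = {a + of_int k * T<..<b + of_int k * T}"
        by (auto simp: U_def)
      ultimately have "smooth_on {a + of_int k * T<..<b + of_int k * T} R" by simp
      moreover have "x \<in> {a + of_int k * T<..<b + of_int k * T}"
        using k ab by auto
      ultimately show ?thesis by (intro exI[of _ "{a + of_int k * T<..<b + of_int k * T}"]) auto
    qed
  qed
qed

section \<open>The finite part as an integral of the remainder\<close>

lemma tendsto_integral_shrink:
  fixes R :: "real \<Rightarrow> real"
  assumes T: "T > 0" and R: "continuous_on {t..t + T} R"
  shows "((\<lambda>e. integral {t + e..t + T - e} R) \<longlongrightarrow> integral {t..t + T} R) (at_right 0)"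
proof -
  have int: "R integrable_on {t..t + T}" using R by (rule integrable_continuous_real)
  define I where "I = (\<lambda>x. integral {t..x} R)"
  have I: "continuous_on {t..t + T} I"
    unfolding I_def by (rule indefinite_integral_continuous_1[OF int])
  have range: "eventually (\<lambda>e. e \<in> {0<..<T / 2}) (at_right (0::real))"
    using T by (intro eventually_at_right_real) auto
  have lim: "((\<lambda>e::real. t + e) \<longlongrightarrow> t) (at_right 0)" "((\<lambda>e. t + T - e) \<longlongrightarrow> t + T) (at_right 0)"
    by (auto intro!: tendsto_eq_intros)
  have "((\<lambda>e. I (t + T - e) - I (t + e)) \<longlongrightarrow> I (t + T) - I t) (at_right 0)"
    using T by (intro tendsto_diff continuous_on_tendsto_compose[OF I] lim
        eventually_mono[OF range]) auto
  moreover have "eventually (\<lambda>e. I (t + T - e) - I (t + e) = integral {t + e..t + T - e} R) (at_right 0)"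
  proof (rule eventually_mono[OF range])
    fix e assume e: "e \<in> {0<..<T / 2}"
    have "R integrable_on {t..t + T - e}"
      by (rule integrable_subinterval_real[OF int]) (use e in auto)
    then show "I (t + T - e) - I (t + e) = integral {t + e..t + T - e} R"
      unfolding I_def using Henstock_Kurzweil_Integration.integral_combine[of t "t + e" "t + T - e" R] e by simp
  qed
  ultimately show ?thesis by (simp add: I_def tendsto_cong)
qed

text \<open>
  By periodicity the two integrals in the finite part join to a single one from \<open>t + \<epsilon>\<close> to
  \<open>t + T - \<epsilon>\<close>. The discarded terms, with \<open>i = m - 1 - n\<close>, are those of
  \<open>tendsto_integral_scaled_kernel\<close>.
\<close>
lemma hadamard_finite_part_eq_integral:
  assumes ab: "a < t" "t < b" "T = b - a" and m: "m \<ge> 1"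
    and S: "S = {x. (x - t) / T \<notin> \<int>}"
    and per: "\<And>x. x \<in> S \<Longrightarrow> f (x + T) = f x"
    and R: "continuous_on UNIV R"
    and f: "\<And>x. x \<in> S \<Longrightarrow> f x = (\<Sum>n<m. c n * scaled_kernel T t n x) + R x"
    and c: "c = (\<lambda>n. (deriv ^^ (m - Suc n)) g t / fact (m - Suc n))"
  shows "hadamard_finite_part a b t m g f = integral {t..t + T} R"
proof -
  have T: "T > 0" using ab by simp
  \<comment> \<open>Small enough for all the intervals below to be ordered as written.\<close>
  define d where "d = min (min (t - a) (b - t)) (T / 2)"
  have d: "d > 0" "d \<le> t - a" "d \<le> b - t" "d \<le> T / 2" unfolding d_def using ab by linarith+
  have range: "eventually (\<lambda>e. e \<in> {0<..<d}) (at_right (0::real))"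
    using d by (intro eventually_at_right_real) auto
  have notint: "x \<in> S" if "\<bar>x - t\<bar> < T" "x \<noteq> t" for x
    using divide_period_not_Ints[OF that] by (simp add: S)
  define J where "J = (\<lambda>n e. integral {t + e..t + T - e} (scaled_kernel T t n)
             - (1 - (-1) ^ n) / (real n * e ^ n))"
  define B where "B = (\<lambda>e. integral {a..t - e} f + integral {t + e..b} f
       - (\<Sum>i<m - 1. (1 + (-1) powi (int i - int m)) * ((deriv ^^ i) g t / fact i)
            * (e powi (int i - int m + 1) / (real m - 1 - real i))))"
  have B: "B e = (\<Sum>n<m. c n * J n e) + integral {t + e..t + T - e} R" if e: "e \<in> {0<..<d}" for e
  proof -
    have K: "continuous_on {t + e..t + T - e} (scaled_kernel T t n)" for n
    proof (rule DERIV_continuous_on)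
      fix x assume "x \<in> {t + e..t + T - e}"
      then have "\<bar>x - t\<bar> < T" "x \<noteq> t" using e by auto
      then have "(x - t) / T \<notin> \<int>" by (rule divide_period_not_Ints)
      with T show "(scaled_kernel T t n has_real_derivative - real (Suc n) * scaled_kernel T t (Suc n) x)
          (at x within {t + e..t + T - e})"
        by (intro has_field_derivative_at_within[OF DERIV_scaled_kernel]) simp_all
    qed
    have dec: "f x = (\<Sum>n<m. c n * scaled_kernel T t n x) + R x" if "x \<in> {t + e..t + T - e}" for x
    proof -
      have "\<bar>x - t\<bar> < T" "x \<noteq> t" using that e by auto
      then have "x \<in> S" by (rule notint)
      then show ?thesis by (rule f)
    qed
    have cont: "continuous_on {t + e..t + T - e} (\<lambda>x. (\<Sum>n<m. c n * scaled_kernel T t n x) + R x)"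
      by (intro continuous_on_add continuous_on_sum continuous_on_mult continuous_on_const K
          continuous_on_subset[OF R subset_UNIV])
    have int: "f integrable_on {t + e..t + T - e}"
      by (rule integrable_eq[OF integrable_continuous_real[OF cont]]) (rule dec[symmetric])
    have "integral {a..t - e} f = integral {a..t - e} (\<lambda>x. f (x + T))"
    proof (intro integral_cong per[symmetric] notint)
      fix x assume "x \<in> {a..t - e}"
      then show "\<bar>x - t\<bar> < T" "x \<noteq> t" using ab e by auto
    qed
    also have "\<dots> = integral {b..t + T - e} f"
      using integral_shift_real_ivl[of b T "t + T - e" f] ab by simp
    finally have "integral {a..t - e} f + integral {t + e..b} f = integral {t + e..t + T - e} f"
      using Henstock_Kurzweil_Integration.integral_combine[OF _ _ int, of b] ab e d by simp
    also have "\<dots> = integral {t + e..t + T - e} (\<lambda>x. (\<Sum>n<m. c n * scaled_kernel T t n x) + R x)"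
      by (intro integral_cong dec)
    also have "\<dots> = (\<Sum>n<m. c n * integral {t + e..t + T - e} (scaled_kernel T t n))
        + integral {t + e..t + T - e} R"
    proof -
      have "integral {t + e..t + T - e} (\<lambda>x. \<Sum>n<m. c n * scaled_kernel T t n x)
          = (\<Sum>n<m. integral {t + e..t + T - e} (\<lambda>x. c n * scaled_kernel T t n x))"
        by (intro integral_sum integrable_continuous_real continuous_intros K) auto
      moreover have "integral {t + e..t + T - e} (\<lambda>x. (\<Sum>n<m. c n * scaled_kernel T t n x) + R x)
          = integral {t + e..t + T - e} (\<lambda>x. \<Sum>n<m. c n * scaled_kernel T t n x)
            + integral {t + e..t + T - e} R"
        by (intro integral_add integrable_continuous_real continuous_intros K
            continuous_on_subset[OF R]) auto
      ultimately show ?thesis by simp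
    qed
    finally have 1: "integral {a..t - e} f + integral {t + e..b} f
        = (\<Sum>n<m. c n * integral {t + e..t + T - e} (scaled_kernel T t n))
          + integral {t + e..t + T - e} R" .
    obtain M where M: "m = Suc M" using m by (cases m) auto
    have "(\<Sum>n<m. c n * ((1 - (-1) ^ n) / (real n * e ^ n)))
        = (\<Sum>i<m. c (m - Suc i) * ((1 - (-1) ^ (m - Suc i)) / (real (m - Suc i) * e ^ (m - Suc i))))"
      by (rule sum.nat_diff_reindex[symmetric])
    also have "\<dots> = (\<Sum>i<M. c (M - i) * ((1 - (-1) ^ (M - i)) / (real (M - i) * e ^ (M - i))))"
      by (simp add: M)
    also have "\<dots> = (\<Sum>i<m - 1. (1 + (-1) powi (int i - int m)) * ((deriv ^^ i) g t / fact i)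
            * (e powi (int i - int m + 1) / (real m - 1 - real i)))"
    proof (rule sum.cong)
      fix i assume "i \<in> {..<m - 1}"
      then obtain n where n: "M = i + n" by (auto simp: M dest: less_imp_add_positive)
      have "(-1 :: real) powi (int i - int m) = - ((-1) ^ n)"
      proof -
        have "int i - int m = - int (Suc n)" by (simp add: M n)
        then show ?thesis
          by (simp only: power_int_minus power_int_of_nat power_inverse[symmetric]) simp
      qed
      moreover have "e powi (int i - int m + 1) = 1 / e ^ n"
      proof -
        have "int i - int m + 1 = - int n" by (simp add: M n)
        then show ?thesis by (simp only: power_int_minus power_int_of_nat inverse_eq_divide)
      qed
      ultimately show "c (M - i) * ((1 - (-1) ^ (M - i)) / (real (M - i) * e ^ (M - i)))
          = (1 + (-1) powi (int i - int m)) * ((deriv ^^ i) g t / fact i)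
            * (e powi (int i - int m + 1) / (real m - 1 - real i))"
        by (simp add: c M n mult_ac)
    qed (simp add: M)
    finally show ?thesis
      unfolding B_def 1 J_def by (simp add: right_diff_distrib sum_subtractf)
  qed
  have "((\<lambda>e. (\<Sum>n<m. c n * J n e) + integral {t + e..t + T - e} R)
      \<longlongrightarrow> (\<Sum>n<m. c n * 0) + integral {t..t + T} R) (at_right 0)"
    unfolding J_def
    by (intro tendsto_intros tendsto_integral_scaled_kernel[OF T]
        tendsto_integral_shrink[OF T] continuous_on_subset[OF R]) auto
  moreover have "eventually (\<lambda>e. (\<Sum>n<m. c n * J n e) + integral {t + e..t + T - e} R = B e) (at_right 0)"
    by (rule eventually_mono[OF range]) (simp add: B)
  ultimately have "(B \<longlongrightarrow> integral {t..t + T} R) (at_right 0)"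
    using Lim_transform_eventually by fastforce
  then show ?thesis
    unfolding hadamard_finite_part_def B_def by (intro tendsto_Lim) auto
qed

section \<open>The quadrature formula as a trapezoidal sum of the remainder\<close>

lemma sum_odd_indices:
  fixes G :: "nat \<Rightarrow> real"
  assumes "\<And>k. even k \<Longrightarrow> G k = 0" and "p \<le> 1"
  shows "(\<Sum>k<2 * r + p. G k) = (\<Sum>l<r. G (2 * l + 1))"
proof -
  have "(\<Sum>k<2 * r. G k) = (\<Sum>l<r. G (2 * l + 1))"
    by (induction r) (auto simp: assms(1))
  moreover have "p = 0 \<or> p = 1" using assms(2) by auto
  ultimately show ?thesis by (auto simp: assms(1))
qed

text \<open>
  At the nodes, each kernel contributes a zeta value times \<open>h\<^bsup>-(k+1)\<^esup> - T\<^bsup>-(k+1)\<^esup>\<close>. After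
  multiplication by \<open>h\<close> the terms \<open>h\<^bsup>-k\<^esup>\<close> are those subtracted in the formula, where \<open>i < r\<close>
  corresponds to \<open>k = 2 (r - i) - 1\<close> for both parities of \<open>m\<close>. The terms \<open>T\<^bsup>-(k+1)\<^esup>\<close> and the
  correction with \<open>i = r\<close> form the summand \<open>h R(t)\<close>.
\<close>
lemma quadrature0_eq_trapezoid:
  assumes T: "T > 0" and n: "n \<ge> 1"
    and S: "S = {x. (x - t) / T \<notin> \<int>}"
    and f: "\<And>x. x \<in> S \<Longrightarrow> f x = (\<Sum>k<m. c k * scaled_kernel T t k x) + R x"
    and Rt: "R t = (deriv ^^ m) g t / fact m - (\<Sum>k<m. c k * scaled_kernel_regular T t k t)"
    and c: "c = (\<lambda>k. (deriv ^^ (m - Suc k)) g t / fact (m - Suc k))"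
  shows "quadrature0 T t m g f n = T / real n * (\<Sum>j<n. R (t + real j * (T / real n)))"
proof -
  define h where "h = T / real n"
  have h: "h > 0" using T n by (simp add: h_def)
  \<comment> \<open>The number \<open>z k\<close> serves twice: it gives the sum over the nodes and the regular part at \<open>t\<close>.\<close>
  define z where "z = (\<lambda>k. if even k then 0 else 2 * Re (riemann_zeta (of_nat (Suc k))))"
  have zs: "(\<lambda>q. 1 / real (Suc q) ^ Suc k) sums Re (riemann_zeta (of_nat (Suc k)))" if "odd k" for k
    using that by (intro Re_riemann_zeta_of_nat) (auto elim: oddE)
  have sum_z: "(\<Sum>j=1..<n. pole_kernel k (real j / real n)) = z k * (real n ^ Suc k - 1)" for k
    using sum_pole_kernel_odd[OF _ zs n, of k] sum_pole_kernel_even[of k n]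
    by (cases "even k") (simp_all add: z_def)
  have reg_z: "scaled_kernel_regular T t k t = z k / T ^ Suc k" for k
    using pole_kernel_regular_0_odd[OF _ zs, of k] pole_kernel_regular_0_even[of k]
    by (cases "even k") (simp_all add: z_def scaled_kernel_regular_def)
  have "(\<Sum>j=1..<n. f (t + real j * h))
      = (\<Sum>j=1..<n. (\<Sum>k<m. c k * (pole_kernel k (real j / real n) / T ^ Suc k)) + R (t + real j * h))"
  proof (rule sum.cong[OF refl])
    fix j assume j: "j \<in> {1..<n}"
    have eq: "(t + real j * h - t) / T = real j / real n" using T by (simp add: h_def)
    have "\<bar>t + real j * h - t\<bar> < T" using j n T by (simp add: h_def field_simps)
    then have "t + real j * h \<in> S"
      using divide_period_not_Ints[of "t + real j * h" t T] j h by (simp add: S)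
    then show "f (t + real j * h)
        = (\<Sum>k<m. c k * (pole_kernel k (real j / real n) / T ^ Suc k)) + R (t + real j * h)"
      by (simp only: f scaled_kernel_def eq)
  qed
  also have "\<dots> = (\<Sum>k<m. c k * (z k * (real n ^ Suc k - 1) / T ^ Suc k)) + (\<Sum>j=1..<n. R (t + real j * h))"
    unfolding sum.distrib sum.swap[of _ "{..<m}"] sum_z[symmetric]
    by (simp only: sum_distrib_left sum_divide_distrib)
  finally have punct: "punctured_trapezoid T t f n
      = h * (\<Sum>k<m. c k * (z k * (real n ^ Suc k - 1) / T ^ Suc k)) + h * (\<Sum>j=1..<n. R (t + real j * h))"
    by (simp add: punctured_trapezoid_def Let_def h_def distrib_left)
  define a where "a = (\<lambda>i. (deriv ^^ i) g t / fact i)"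
  define G where "G = (\<lambda>k. c k * z k / h ^ k)"
  define p where "p = m mod 2"
  define r where "r = m div 2"
  have m: "m = 2 * r + p" and p: "p \<le> 1" by (simp_all add: p_def r_def)
  have "quadrature0 T t m g f n = punctured_trapezoid T t f n
      - 2 * (\<Sum>i\<le>r. a (2 * i + p) * Re (riemann_zeta (of_nat (2 * r - 2 * i)))
              * h powi (- 2 * int r + 2 * int i + 1))"
  proof (cases "even m")
    case True
    then have "p = 0" by (simp add: p_def)
    then show ?thesis unfolding quadrature0_def Let_def h_def r_def a_def
      using True by (simp only: if_True add_0_right)
  next
    case False
    then have "p = 1" by (simp add: p_def odd_iff_mod_2_eq_one)
    then show ?thesis unfolding quadrature0_def Let_def h_def r_def a_def
      using False by (simp only: if_False)
  qed
  also have "(\<Sum>i\<le>r. a (2 * i + p) * Re (riemann_zeta (of_nat (2 * r - 2 * i)))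
              * h powi (- 2 * int r + 2 * int i + 1))
      = (\<Sum>i<r. a (2 * i + p) * Re (riemann_zeta (of_nat (2 * r - 2 * i)))
              * h powi (- 2 * int r + 2 * int i + 1)) - a m * h / 2"
    by (simp add: lessThan_Suc_atMost[symmetric] riemann_zeta_0 m)
  also have "(\<Sum>i<r. a (2 * i + p) * Re (riemann_zeta (of_nat (2 * r - 2 * i)))
              * h powi (- 2 * int r + 2 * int i + 1))
      = (\<Sum>i<r. G (2 * (r - Suc i) + 1) / 2)"
  proof (rule sum.cong[OF refl])
    fix i assume "i \<in> {..<r}"
    then obtain l where l: "r = Suc (i + l)" by (auto dest: less_imp_Suc_add)
    have "- 2 * int r + 2 * int i + 1 = - int (2 * l + 1)" by (simp add: l)
    then have "h powi (- 2 * int r + 2 * int i + 1) = 1 / h ^ (2 * l + 1)"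
      by (simp only: power_int_minus power_int_of_nat inverse_eq_divide)
    moreover have "2 * r - 2 * i = Suc (2 * l + 1)" "r - Suc i = l"
      "m - Suc (2 * l + 1) = 2 * i + p" by (simp_all add: l m)
    ultimately show "a (2 * i + p) * Re (riemann_zeta (of_nat (2 * r - 2 * i)))
              * h powi (- 2 * int r + 2 * int i + 1) = G (2 * (r - Suc i) + 1) / 2"
      by (simp only: G_def c a_def z_def) simp
  qed
  also have "\<dots> = (\<Sum>k<m. G k) / 2"
    unfolding sum_divide_distrib[symmetric] m
    using sum.nat_diff_reindex[of "\<lambda>l. G (2 * l + 1)" r]
    by (subst sum_odd_indices[OF _ p]) (auto simp: G_def z_def)
  finally have quad: "quadrature0 T t m g f n = punctured_trapezoid T t f n - (\<Sum>k<m. G k) + a m * h"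
    by simp
  have kernels: "h * (\<Sum>k<m. c k * (z k * (real n ^ Suc k - 1) / T ^ Suc k))
      = (\<Sum>k<m. G k) - h * (\<Sum>k<m. c k * (z k / T ^ Suc k))"
  proof -
    have "h * (c k * (z k * (real n ^ Suc k - 1) / T ^ Suc k)) = G k - h * (c k * (z k / T ^ Suc k))" for k
    proof -
      have "h * (real n ^ Suc k / T ^ Suc k) = 1 / h ^ k"
        using T n by (simp add: h_def power_divide field_simps)
      then have "G k = c k * z k * (h * (real n ^ Suc k / T ^ Suc k))"
        by (simp add: G_def)
      then show ?thesis by (simp add: diff_divide_distrib algebra_simps)
    qed
    then show ?thesis by (simp add: sum_distrib_left sum_subtractf)
  qed
  have "{..<n} = insert 0 {1..<n}" using n by auto
  then have nodes: "(\<Sum>j<n. R (t + real j * h)) = R t + (\<Sum>j=1..<n. R (t + real j * h))" by simp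
  have at_t: "R t = a m - (\<Sum>k<m. c k * (z k / T ^ Suc k))"
    unfolding Rt reg_z a_def ..
  have "(u - h * w) + h * v - u + x * h = h * ((x - w) + v)" for u v w x :: real
    by (simp add: algebra_simps)
  then show ?thesis
    unfolding h_def[symmetric] quad punct kernels nodes at_t .
qed

section \<open>Extrapolation and the error estimate\<close>

text \<open>
  The exponents \<open>2 s - 1\<close> are odd, hence not zero.
\<close>
lemma richardson_factor_neq_1: "(2::real) powi (- richardson_exponent (Suc s)) \<noteq> 1"
proof (cases s)
  case 0
  then show ?thesis by (simp add: richardson_exponent_def power_int_minus)
next
  case (Suc u)
  have "- richardson_exponent (Suc s) = int (2 * u + 1)"
    by (simp add: richardson_exponent_def Suc)
  then have "(2::real) powi (- richardson_exponent (Suc s)) = 2 ^ (2 * u + 1)"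
    by (simp only: power_int_of_nat)
  also have "\<dots> > 1" by (rule one_less_power) auto
  finally show ?thesis by simp
qed

text \<open>
  The weights of a Richardson step add up to one, so that the errors are combined in the same way
  as the values, and the bound is multiplied by a constant.
\<close>
lemma quadrature_error_bound:
  assumes "\<exists>C. \<forall>n\<ge>1. \<bar>quadrature0 T t m g f n - I\<bar> \<le> C / real n ^ K"
  shows "\<exists>C. \<forall>n\<ge>1. \<bar>quadrature s T t m g f n - I\<bar> \<le> C / real n ^ K"
proof (induction s)
  case 0
  then show ?case using assms by simp
next
  case (Suc s)
  define q where "q = (2::real) powi (- richardson_exponent (Suc s))"
  have q: "1 - q \<noteq> 0" using richardson_factor_neq_1[of s] by (simp add: q_def)
  define E where "E = (\<lambda>n. quadrature s T t m g f n - I)"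
  obtain C where C: "\<And>n. n \<ge> 1 \<Longrightarrow> \<bar>E n\<bar> \<le> C / real n ^ K" using Suc by (auto simp: E_def)
  have "C \<ge> 0" using order.trans[OF abs_ge_zero C[of 1]] by simp
  show ?case
  proof (intro exI allI impI)
    fix n :: nat assume n: "n \<ge> 1"
    have "\<bar>E (2 * n)\<bar> \<le> C / real (2 * n) ^ K" using n by (intro C) auto
    also have "\<dots> \<le> C / real n ^ K"
      using n \<open>C \<ge> 0\<close> by (intro divide_left_mono power_mono) auto
    finally have "\<bar>E (2 * n) - q * E n\<bar> \<le> C / real n ^ K + \<bar>q\<bar> * (C / real n ^ K)"
      using mult_left_mono[OF C[OF n] abs_ge_zero[of q]] by (simp add: abs_mult[symmetric])
    moreover have "quadrature (Suc s) T t m g f n - I = (E (2 * n) - q * E n) / (1 - q)"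
      using q by (simp add: E_def Let_def field_simps flip: q_def)
    ultimately have "\<bar>quadrature (Suc s) T t m g f n - I\<bar>
        \<le> (C / real n ^ K + \<bar>q\<bar> * (C / real n ^ K)) / \<bar>1 - q\<bar>"
      using q by (simp only: abs_divide) (intro divide_right_mono; simp)
    also have "\<dots> = (C + \<bar>q\<bar> * C) / \<bar>1 - q\<bar> / real n ^ K"
      by (simp add: add_divide_distrib mult.commute)
    finally show "\<bar>quadrature (Suc s) T t m g f n - I\<bar> \<le> (C + \<bar>q\<bar> * C) / \<bar>1 - q\<bar> / real n ^ K" .
  qed
qed

lemma smallo_powr_of_bounds:
  fixes E :: "nat \<Rightarrow> real"
  assumes "\<And>K. \<exists>C. \<forall>n\<ge>1. \<bar>E n\<bar> \<le> C / real n ^ K"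
  shows "E \<in> o(\<lambda>n. real n powr (- \<mu>))"
proof -
  define K where "K = nat \<lceil>\<mu>\<rceil> + 1"
  have K: "real K > \<mu>" unfolding K_def using of_nat_ceiling[of \<mu>] by simp
  obtain C where C: "\<And>n. n \<ge> 1 \<Longrightarrow> \<bar>E n\<bar> \<le> C / real n ^ K" using assms by blast
  have "E \<in> O(\<lambda>n. real n powr (- real K))"
  proof (rule bigoI)
    show "\<forall>\<^sub>F n in sequentially. norm (E n) \<le> C * norm (real n powr (- real K))"
      using eventually_ge_at_top[of 1]
    proof eventually_elim
      case (elim n)
      then show ?case using C[of n] by (simp add: powr_minus powr_realpow inverse_eq_divide)
    qed
  qed
  also have "(\<lambda>n. real n powr (- real K)) \<in> o(\<lambda>n. real n powr (- \<mu>))"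
    using K by real_asymp
  finally show ?thesis .
qed

theorem theorem4p1:
  fixes a b t T :: real and m s :: nat and f g :: "real \<Rightarrow> real" and R\<^sub>t :: "real set"
  assumes "a < t" and "t < b" and "T = b - a" and "m \<ge> 1"
    and "smooth_on {a..b} g"
    and "R\<^sub>t = - {t + of_int k * T | k :: int. True}"
    and "\<And>x. x \<in> R\<^sub>t \<Longrightarrow> f (x + T) = f x"
    and "smooth_on R\<^sub>t f"
    and "\<And>x. x \<in> {a..b} - {t} \<Longrightarrow> f x = g x / (x - t) ^ m"
  shows "(\<lambda>n. quadrature s T t m g f n) \<longlonglongrightarrow> hadamard_finite_part a b t m g f \<and>
    (\<forall>\<mu>>0. (\<lambda>n. quadrature s T t m g f n - hadamard_finite_part a b t m g f)
               \<in> o(\<lambda>n. real n powr (- \<mu>)))"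
proof -
  note ab = assms(1-3)
  have T: "T > 0" using ab by simp
  have S: "R\<^sub>t = {x. (x - t) / T \<notin> \<int>}"
  proof -
    have "(x - t) / T \<in> \<int> \<longleftrightarrow> (\<exists>k::int. x = t + of_int k * T)" for x
      using T by (auto simp: field_simps elim!: Ints_cases)
    then show ?thesis unfolding assms(6) by auto
  qed
  obtain F where F: "F 0 = g"
    "\<And>k x. x \<in> {a..b} \<Longrightarrow> (F k has_real_derivative F (Suc k) x) (at x within {a..b})"
    using assms(5) unfolding smooth_on_def by blast
  have F': "(F k has_real_derivative F (Suc k) x) (at x)" if "x \<in> {a<..<b}" for k x
  proof -
    have "(F k has_real_derivative F (Suc k) x) (at x within {a<..<b})"
      by (rule has_field_derivative_subset[OF F(2)]) (use that in auto)
    then show ?thesis using that by (simp add: at_within_open[of x "{a<..<b}"])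
  qed
  have Ft: "F k t = (deriv ^^ k) g t" for k
    using iterated_deriv_eq[where F = F and S = "{a<..<b}", OF _ F'] ab F(1) by simp
  define c where "c = (\<lambda>n. F (m - Suc n) t / fact (m - Suc n))"
  have c: "c = (\<lambda>n. (deriv ^^ (m - Suc n)) g t / fact (m - Suc n))" by (simp add: c_def Ft)
  obtain R where R: "smooth_on UNIV R" "\<And>x. R (x + T) = R x"
    "\<And>x. x \<in> R\<^sub>t \<Longrightarrow> f x = (\<Sum>n<m. c n * scaled_kernel T t n x) + R x"
    "R t = F m t / fact m - (\<Sum>n<m. c n * scaled_kernel_regular T t n t)"
    using smooth_periodic_remainder[where F = F and c = c and f = f and m = m, OF ab F(2) S assms(7,8)]
      assms(9) F(1) c_def by blast
  obtain D where D: "D 0 = R" "\<And>k x. (D k has_real_derivative D (Suc k) x) (at x)"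
    using R(1) unfolding smooth_on_def by auto
  have contR: "continuous_on UNIV R"
    using D by (metis DERIV_isCont continuous_at_imp_continuous_on)
  define I where "I = hadamard_finite_part a b t m g f"
  have I: "I = integral {t..t + T} R"
    unfolding I_def
    by (rule hadamard_finite_part_eq_integral[OF ab assms(4) S assms(7) contR R(3) c])
  have quad0: "\<exists>C. \<forall>n\<ge>1. \<bar>quadrature0 T t m g f n - I\<bar> \<le> C / real n ^ K" for K
  proof -
    obtain C where C: "\<And>n. n \<ge> 1 \<Longrightarrow> \<bar>T / real n * (\<Sum>j<n. D 0 (t + real j * (T / real n)))
            - integral {t..t + T} (D 0)\<bar> \<le> C * (T / real n) ^ K"
      using periodic_trapezoid[where F = D and t = t and K = K, OF T D(2)] R(2) D(1) by metis
    have "\<bar>quadrature0 T t m g f n - I\<bar> \<le> C * T ^ K / real n ^ K" if "n \<ge> 1" for n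
      using C[OF that] quadrature0_eq_trapezoid[OF T that S R(3) R(4)[unfolded Ft] c]
      by (simp add: I D(1) power_divide)
    then show ?thesis by blast
  qed
  have small: "(\<lambda>n. quadrature s T t m g f n - I) \<in> o(\<lambda>n. real n powr (- \<mu>))" for \<mu>
    by (intro smallo_powr_of_bounds quadrature_error_bound quad0)
  have "(\<lambda>n. quadrature s T t m g f n - I) \<longlonglongrightarrow> 0"
  proof -
    note small[of 1]
    also have "(\<lambda>n. real n powr (- 1)) \<in> O(\<lambda>_. 1)" by real_asymp
    finally show ?thesis using smalloD_tendsto by force
  qed
  then have "(\<lambda>n. quadrature s T t m g f n) \<longlonglongrightarrow> I" by (simp add: LIM_zero_iff)
  then show ?thesis using small by (simp add: I_def)
qed

end
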